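(* Let $S$ be a countable set and let $\mathfrak{m}$ be a stationary Markov measure (with positive initial distribution) on $S^{<\mathbb{N}}$. For every $1\le p<\infty$ and $f\in L^p(S^{\mathbb{N}},\mathbb{P}_{\mathfrak{m}})$, with $\overline{f}$ denoting the conditional expectation of $f$ with respect to the $\sigma$-algebra of shift-invariant Borel sets, the following hold. (a) For a.e. $x\in S^{\mathbb{N}}$, \[ \frac{1}{\mathfrak{m}(\tau^\frown x(0))}\sum_{w\in\tau}f(w^\frown x)\,\mathfrak{m}(w^\frown x(0))\to\overline{f}(x)\quad\text{as }\mathfrak{m}(\tau^\frown x(0))\to\infty, \] where $\tau$ ranges over $\mathcal{T}_S$. (b) The functions $x\mapsto\frac{1}{(n+1)\mathfrak{m}(x(0))}\sum_{w\in S^{\le n}}f(w^\frown x)\,\mathfrak{m}(w^\frown x(0))$ converge to $\overline{f}$ as $n\to\infty$ both a.e. and in $L^p$. (c) Letting $f^*(x):=\sup_{\tau\in\mathcal{T}_S}\frac{1}{\mathfrak{m}(\tau^\frown x(0))}\sum_{w\in\tau}f(w^\frown x)\,\mathfrak{m}(w^\frown x(0))$, we have \[ \int_{\{f^*>\lambda\}}f\,d\mathbb{P}_{\mathfrak{m}}\ge\lambda\,\mathbb{P}_{\mathfrak{m}}\{f^*>\lambda\} \] for any $\lambda\in\mathbb{R}$. In particular, $f^*<\infty$ a.e.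
   Context: $\mathbb{N}$ includes $0$. $S^{<\mathbb{N}}$ is the set of finite words in $S$, $S^{\le n}$ those of length at most $n$. $u^\frown v$ denotes concatenation, and $\tau^\frown a:=\{w^\frown a:w\in\tau\}$. $\mathcal{T}_S$ is the set of right-rooted (possibly infinite) trees on $S$ of finite height: $\tau\in\mathcal{T}_S$ iff $\tau\subseteq S^{\le n}$ for some $n$, $\tau$ contains the empty word, and $t_1{}^\frown t_2\in\tau$ implies $t_2\in\tau$. The shift is $\sigma(x):=(x(1+n))_{n\in\mathbb{N}}$ on $S^{\mathbb{N}}$. The Markov measure $\mathfrak{m}$ on $S^{<\mathbb{N}}$ with (row-stochastic) transition matrix $P$ and initial distribution $\pi$ is $\mathfrak{m}(w):=\pi(w(0))P(w(0),w(1))\cdots P(w(\ell-2),w(\ell-1))$ for a nonempty word $w$ of length $\ell$, and $\mathfrak{m}(\emptyset):=1$; for a set $A$ of words $\mathfrak{m}(A):=\sum_{w\in A}\mathfrak{m}(w)$. It is stationary if $\pi P=\pi$. Standing assumption: all entries of $\pi$ are positive. $\mathbb{P}_{\mathfrak{m}}$ is the Borel probability measure on $S^{\mathbb{N}}$ with $\mathbb{P}_{\mathfrak{m}}\{x:w\text{ is an initial subword of }x\}=\mathfrak{m}(w)$ for all $w\in S^{<\mathbb{N}}$. The convergence in (a) means: for every $\varepsilon>0$ there is $M>0$ such that for all $\tau\in\mathcal{T}_S$ with $\mathfrak{m}(\tau^\frown x(0))\ge M$ the average is within $\varepsilon$ of $\overline{f}(x)$. *)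

theory Defs
  imports "HOL-Probability.Probability"
begin

section \<open>Words and trees\<close>

text \<open>Words are lists; points of \<open>S\<^sup>\<nat>\<close> are streams over \<open>S\<close>, so that \<open>w @- x\<close> is
  concatenation, \<open>shd x\<close> is \<open>x(0)\<close> and the shift map is \<open>stl\<close>.\<close>

definition words_le :: "'a set \<Rightarrow> nat \<Rightarrow> 'a list set" where
  "words_le S n = {w \<in> lists S. length w \<le> n}"

definition trees :: "'a set \<Rightarrow> 'a list set set" where
  "trees S = {\<tau>. (\<exists>n. \<tau> \<subseteq> words_le S n) \<and> [] \<in> \<tau> \<and> (\<forall>t1 t2. t1 @ t2 \<in> \<tau> \<longrightarrow> t2 \<in> \<tau>)}"

definition app_letter :: "'a list set \<Rightarrow> 'a \<Rightarrow> 'a list set" where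
  "app_letter \<tau> a = (\<lambda>w. w @ [a]) ` \<tau>"

section \<open>Markov measures\<close>

definition stationary_markov :: "'a set \<Rightarrow> ('a \<Rightarrow> 'a \<Rightarrow> real) \<Rightarrow> ('a \<Rightarrow> real) \<Rightarrow> bool" where
  "stationary_markov S P \<pi> \<longleftrightarrow>
     (\<forall>a\<in>S. \<forall>b\<in>S. 0 \<le> P a b) \<and> (\<forall>a\<in>S. (P a has_sum 1) S) \<and>
     (\<forall>a\<in>S. 0 < \<pi> a) \<and> (\<pi> has_sum 1) S \<and>
     (\<forall>b\<in>S. ((\<lambda>a. \<pi> a * P a b) has_sum \<pi> b) S)"

definition markov_word :: "('a \<Rightarrow> 'a \<Rightarrow> real) \<Rightarrow> ('a \<Rightarrow> real) \<Rightarrow> 'a list \<Rightarrow> real" where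
  "markov_word P \<pi> w =
     (if w = [] then 1 else \<pi> (w ! 0) * (\<Prod>i<length w - 1. P (w ! i) (w ! Suc i)))"

text \<open>A real-valued sum: it is the measure only of those sets of words whose measure is finite.
  This includes every \<open>app_letter \<tau> a\<close> with \<open>\<tau> \<in> trees S\<close> and \<open>a \<in> S\<close>: if \<open>\<tau> \<subseteq> words_le S n\<close>,
  stationarity bounds its measure by \<open>(n + 1) * \<pi> a\<close>.\<close>

definition markov_set :: "('a \<Rightarrow> 'a \<Rightarrow> real) \<Rightarrow> ('a \<Rightarrow> real) \<Rightarrow> 'a list set \<Rightarrow> real" where
  "markov_set P \<pi> A = (\<Sum>\<^sub>\<infinity>w\<in>A. markov_word P \<pi> w)"

text \<open>The defining property of the path measure. As \<open>S\<close> is countable, the product sigma-algebra of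
  \<open>stream_space (count_space S)\<close> is the Borel sigma-algebra of \<open>S\<^sup>\<nat>\<close> for discrete \<open>S\<close>, and the
  cylinder probabilities determine the measure uniquely.\<close>

definition is_markov_path_measure ::
    "'a set \<Rightarrow> ('a \<Rightarrow> 'a \<Rightarrow> real) \<Rightarrow> ('a \<Rightarrow> real) \<Rightarrow> 'a stream measure \<Rightarrow> bool" where
  "is_markov_path_measure S P \<pi> M \<longleftrightarrow>
     prob_space M \<and> sets M = sets (stream_space (count_space S)) \<and>
     (\<forall>w\<in>lists S. measure M {x \<in> space M. stake (length w) x = w} = markov_word P \<pi> w)"

section \<open>Invariant sets and \<open>L\<^sup>p\<close>\<close>

definition shift_invariant_algebra :: "'a stream measure \<Rightarrow> 'a stream measure" where
  "shift_invariant_algebra M = sigma (space M) {A \<in> sets M. stl -` A \<inter> space M = A}"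

definition in_Lp :: "real \<Rightarrow> 'b measure \<Rightarrow> ('b \<Rightarrow> real) \<Rightarrow> bool" where
  "in_Lp p M f \<longleftrightarrow> f \<in> borel_measurable M \<and> integrable M (\<lambda>x. \<bar>f x\<bar> powr p)"

text \<open>Since \<open>g n\<close> and \<open>h\<close> are required to be in \<open>L\<^sup>p\<close>, the integrand below is integrable for
  \<open>p \<ge> 1\<close>, so the integral is not a default value.\<close>

definition tendsto_Lp :: "real \<Rightarrow> 'b measure \<Rightarrow> (nat \<Rightarrow> 'b \<Rightarrow> real) \<Rightarrow> ('b \<Rightarrow> real) \<Rightarrow> bool" where
  "tendsto_Lp p M g h \<longleftrightarrow> (\<forall>n. in_Lp p M (g n)) \<and> in_Lp p M h \<and>
     (\<lambda>n. \<integral>x. \<bar>g n x - h x\<bar> powr p \<partial>M) \<longlonglongrightarrow> 0"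

section \<open>Averages over trees\<close>

text \<open>For integrable \<open>f\<close> the sum over \<open>\<tau> \<in> trees S\<close> converges absolutely for almost every \<open>x\<close>, for
  all trees simultaneously; on the exceptional null set its value is the default \<open>0\<close> whenever it
  diverges. There the supremum over uncountably many trees need not be Borel measurable, so the
  set \<open>maximal_function S P \<pi> f x > c\<close> has to be measured by the completion.\<close>

definition weighted_sum ::
    "('a \<Rightarrow> 'a \<Rightarrow> real) \<Rightarrow> ('a \<Rightarrow> real) \<Rightarrow> ('a stream \<Rightarrow> real) \<Rightarrow> 'a list set \<Rightarrow> 'a stream \<Rightarrow> real" where
  "weighted_sum P \<pi> f \<tau> x = (\<Sum>\<^sub>\<infinity>w\<in>\<tau>. f (w @- x) * markov_word P \<pi> (w @ [shd x]))"

definition tree_average ::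
    "('a \<Rightarrow> 'a \<Rightarrow> real) \<Rightarrow> ('a \<Rightarrow> real) \<Rightarrow> ('a stream \<Rightarrow> real) \<Rightarrow> 'a list set \<Rightarrow> 'a stream \<Rightarrow> real" where
  "tree_average P \<pi> f \<tau> x =
     1 / markov_set P \<pi> (app_letter \<tau> (shd x)) * weighted_sum P \<pi> f \<tau> x"

definition maximal_function ::
    "'a set \<Rightarrow> ('a \<Rightarrow> 'a \<Rightarrow> real) \<Rightarrow> ('a \<Rightarrow> real) \<Rightarrow> ('a stream \<Rightarrow> real) \<Rightarrow> 'a stream \<Rightarrow> ereal" where
  "maximal_function S P \<pi> f x = (SUP \<tau>\<in>trees S. ereal (tree_average P \<pi> f \<tau> x))"

end

theory Submission
  imports Defs
begin

text \<open>The theorem becomes an ergodic theorem for a Markov operator once time is reversed. By stationarity,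
\<open>back_prob b a = \<pi> a * P a b / \<pi> b\<close> is the transition probability of the reversed chain, and
\<open>m(w x(0)) / \<pi>(x(0))\<close> is the probability that this chain, started at \<open>x(0)\<close>, writes the word
\<open>w\<close> to the left of \<open>x\<close>. Dividing numerator and denominator of a tree average by \<open>\<pi>(x(0))\<close> turns
it into \<open>tree_sum f \<tau> x / tree_sum 1 \<tau> x\<close>, a quotient of sums weighted by these probabilities.
Let \<open>T\<close> (\<open>transfer\<close>) average a function over one random letter put in front of \<open>x\<close>. The path
measure is invariant under this random prefixing (\<open>backward_extension_eq\<close>), so \<open>T\<close> preserves
integrals, and since removing the first letter undoes the prefixing, \<open>T\<close> is adjoint to composition
with the shift.

A tree is a stopping rule for the reversed chain: branch by branch it decides whether to go on.
The largest tree sum \<open>V n\<close> over trees of height at most \<open>n\<close> (\<open>best_sum\<close>) therefore satisfies the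
dynamic programming equation \<open>V (n + 1) = f + T (max 0 (V n))\<close>. Where \<open>V (n + 1) > 0\<close> this reads
\<open>f = max 0 (V (n + 1)) - T (max 0 (V n))\<close>, and integrating gives, as in Garsia's proof of the
Hopf maximal ergodic theorem, that the integral of \<open>f\<close> over \<open>V (n + 1) > 0\<close> is at least the
integral of \<open>max 0 (V (n + 1)) - max 0 (V n)\<close>, which is nonnegative. The same holds inside any set
that is invariant up to null sets (\<open>maximal_inequality\<close>). Applied to \<open>f - c\<close>, this is the
inequality (c) for the maximal function.

For pointwise convergence apply this to \<open>g = f - fbar - \<epsilon>\<close>. If \<open>V n\<close> is unbounded at \<open>a x\<close> and the
reversed chain can step from \<open>x\<close> to \<open>a x\<close>, then it is unbounded at \<open>x\<close>. Hence the set \<open>A\<close> where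
\<open>V n\<close> is unbounded is contained in its preimage under the measure-preserving shift, and is invariant
up to a null set. The maximal inequality on \<open>A\<close> says \<open>0 \<le> \<integral>\<^sub>A g = - \<epsilon> * measure A\<close>, so \<open>A\<close> is null
(\<open>AE_best_sum_bounded\<close>). Thus, for almost every \<open>x\<close>, tree sums of \<open>f\<close> exceed \<open>fbar x + \<epsilon>\<close> times
the mass of the tree by at most a constant depending on \<open>x\<close> only. Dividing by the mass, and arguing
likewise for \<open>- f\<close>, gives (a) and also the finiteness of the maximal function.

The tree of all words of length at most \<open>n\<close> has mass \<open>n + 1\<close>, so almost everywhere convergence in (b)
is a special case of (a). For convergence in \<open>L\<^sup>p\<close>, Jensen's inequality bounds
\<open>\<bar>average of f - fbar\<bar> powr p\<close> by a multiple of the average of \<open>\<bar>f\<bar> powr p\<close> plus its limit. These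
bounds converge almost everywhere with constant integral, hence in \<open>L\<^sup>1\<close> by Scheffe's lemma, and
dominated convergence with a converging dominating sequence applies.\<close>

section \<open>Countable sums, words and powers\<close>

lemma summable_on_iff_integrable_count_space:
  fixes f :: "'b \<Rightarrow> real"
  shows "f summable_on A \<longleftrightarrow> integrable (count_space A) f"
  by (metis abs_summable_equivalent abs_summable_on_def summable_on_iff_abs_summable_on_real)

text \<open>For real-valued functions both sides take the default value \<open>0\<close> when the sum diverges. As an integral,
an infinite sum depends measurably on parameters and obeys Fubini's theorem.\<close>

lemma infsum_eq_integral_count_space:
  fixes f :: "'b \<Rightarrow> real"
  shows "infsum f A = (LINT x|count_space A. f x)"
proof (cases "f summable_on A")
  case True
  then have "Infinite_Set_Sum.abs_summable_on f A"
    by (simp add: summable_on_iff_integrable_count_space abs_summable_on_def)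
  then show ?thesis
    by (simp add: infsetsum_infsum[symmetric] infsetsum_def)
next
  case False
  then show ?thesis
    by (simp add: infsum_not_exists summable_on_iff_integrable_count_space not_integrable_integral_eq)
qed

lemma nn_integral_count_space_has_sum:
  assumes "(f has_sum s) A" "\<And>x. x \<in> A \<Longrightarrow> 0 \<le> f x"
  shows "(\<integral>\<^sup>+x. ennreal (f x) \<partial>count_space A) = ennreal s"
proof -
  have "integrable (count_space A) f"
    using assms(1) summable_on_iff_integrable_count_space has_sum_imp_summable by blast
  then have "(\<integral>\<^sup>+x. ennreal (f x) \<partial>count_space A) = ennreal (LINT x|count_space A. f x)"
    by (intro nn_integral_eq_integral) (auto simp: AE_count_space assms(2))
  then show ?thesis
    using infsumI[OF assms(1)] infsum_eq_integral_count_space[of f A] by simp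
qed

lemma markov_word_snoc:
  "markov_word P \<pi> (w @ [a, b]) = markov_word P \<pi> (w @ [a]) * P a b"
proof -
  have "(\<Prod>i<length w. P ((w @ [a, b]) ! i) ((w @ [a, b]) ! Suc i)) =
        (\<Prod>i<length w. P ((w @ [a]) ! i) ((w @ [a]) ! Suc i))"
    by (rule prod.cong) (auto simp: nth_append less_Suc_eq)
  then show ?thesis
    by (cases w) (auto simp: markov_word_def nth_append)
qed

lemma markov_word_Cons:
  "markov_word P \<pi> (a # b # w) * \<pi> b = \<pi> a * P a b * markov_word P \<pi> (b # w)"
  by (simp add: markov_word_def prod.lessThan_Suc_shift del: prod.lessThan_Suc)

lemma words_le_0: "words_le S 0 = {[]}"
  by (auto simp: words_le_def)

lemma words_le_in_trees: "words_le S n \<in> trees S"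
  by (auto simp: trees_def words_le_def)

text \<open>Convexity of \<open>t powr p\<close>, in the form in which it yields Jensen's inequality for infinite weighted sums
by summation of both sides. For positive \<open>s\<close> the line is the tangent at \<open>s\<close>; at \<open>t = 0\<close>, the boundary
of the interval of convexity, the inequality reduces to \<open>s powr p \<le> p * s powr p\<close>.\<close>

lemma powr_supporting_line:
  fixes s p :: real
  assumes "0 \<le> s" "1 \<le> p"
  obtains c where "\<And>t. 0 \<le> t \<Longrightarrow> s powr p + c * (t - s) \<le> t powr p"
proof (cases "s = 0")
  case True
  then show ?thesis using that[of 0] by simp
next
  case False
  then have s: "0 < s" using assms by simp
  have "s powr p + (p * s powr (p - 1)) * (t - s) \<le> t powr p" if "0 \<le> t" for t
  proof (cases "t = 0")
    case True
    have "s powr (p - 1) * s = s powr p"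
      using s by (simp add: powr_diff)
    moreover have "s powr p \<le> p * s powr p"
      using assms(2) by (simp add: mult_le_cancel_right1)
    ultimately show ?thesis using True by (simp add: mult.assoc)
  next
    case False
    then have "t powr p - s powr p \<ge> (p * s powr (p - 1)) * (t - s)"
      using s that
      by (intro convex_on_imp_above_tangent[OF powr_convex[OF assms(2)]])
         (auto intro!: derivative_eq_intros simp: interior_open)
    then show ?thesis by simp
  qed
  then show ?thesis by (rule that)
qed

lemma in_Lp_imp_integrable:
  assumes "finite_measure M" "1 \<le> p" "in_Lp p M f"
  shows "integrable M f"
proof (rule Bochner_Integration.integrable_bound)
  interpret finite_measure M by fact
  show "integrable M (\<lambda>x. 1 + \<bar>f x\<bar> powr p)"
    using assms(3) by (simp add: in_Lp_def)
  have "\<bar>t\<bar> \<le> 1 + \<bar>t\<bar> powr p" for t :: real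
  proof (cases "\<bar>t\<bar> \<le> 1")
    case False
    then have "\<bar>t\<bar> powr 1 \<le> \<bar>t\<bar> powr p" using assms(2) by (intro powr_mono) auto
    then show ?thesis using False by simp
  qed (simp add: add_increasing2)
  then show "AE x in M. norm (f x) \<le> norm (1 + \<bar>f x\<bar> powr p)" by simp
qed (use assms(3) in \<open>simp add: in_Lp_def\<close>)

text \<open>Dominated convergence with a varying dominating function. Since
\<open>d n \<le> min (d n) \<bar>h\<bar> + \<bar>H n - h\<bar>\<close>, the first summand is handled by ordinary dominated convergence
and the second by the assumed convergence in \<open>L\<^sup>1\<close>.\<close>

lemma tendsto_integral_zero_dominated_by_L1_convergent:
  fixes d H :: "nat \<Rightarrow> 'b \<Rightarrow> real" and h :: "'b \<Rightarrow> real"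
  assumes d [measurable]: "\<And>n. d n \<in> borel_measurable M"
    and "\<And>n x. 0 \<le> d n x" "AE x in M. (\<lambda>n. d n x) \<longlonglongrightarrow> 0"
    and H: "\<And>n. integrable M (H n)" and h: "integrable M h"
    and dom: "\<And>n. AE x in M. d n x \<le> H n x" and h_nonneg: "AE x in M. 0 \<le> h x"
    and L1: "(\<lambda>n. LINT x|M. \<bar>H n x - h x\<bar>) \<longlonglongrightarrow> 0"
  shows "(\<lambda>n. LINT x|M. d n x) \<longlonglongrightarrow> 0"
proof -
  have [measurable]: "h \<in> borel_measurable M" using h by simp
  have min_int: "integrable M (\<lambda>x. min (d n x) \<bar>h x\<bar>)" for n
    by (rule Bochner_Integration.integrable_bound[OF h]) (auto simp: assms(2))
  have "(\<lambda>n. LINT x|M. min (d n x) \<bar>h x\<bar>) \<longlonglongrightarrow> (LINT x|M. 0)"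
  proof (rule integral_dominated_convergence)
    show "integrable M (\<lambda>x. \<bar>h x\<bar>)" using h by simp
    show "AE x in M. (\<lambda>n. min (d n x) \<bar>h x\<bar>) \<longlonglongrightarrow> 0"
      using assms(3)
    proof eventually_elim
      case (elim x)
      show ?case
        by (rule tendsto_sandwich[OF _ _ tendsto_const elim]) (auto simp: assms(2))
    qed
  qed (auto simp: assms(2))
  then have "(\<lambda>n. (LINT x|M. min (d n x) \<bar>h x\<bar>) + (LINT x|M. \<bar>H n x - h x\<bar>)) \<longlonglongrightarrow> 0 + 0"
    using L1 by (intro tendsto_add) simp_all
  then have lim: "(\<lambda>n. (LINT x|M. min (d n x) \<bar>h x\<bar>) + (LINT x|M. \<bar>H n x - h x\<bar>)) \<longlonglongrightarrow> 0"
    by simp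
  have "(LINT x|M. d n x) \<le> (LINT x|M. min (d n x) \<bar>h x\<bar>) + (LINT x|M. \<bar>H n x - h x\<bar>)" for n
  proof -
    have "(LINT x|M. d n x) \<le> (LINT x|M. min (d n x) \<bar>h x\<bar> + \<bar>H n x - h x\<bar>)"
    proof (rule integral_mono_AE)
      show "AE x in M. d n x \<le> min (d n x) \<bar>h x\<bar> + \<bar>H n x - h x\<bar>"
        using dom[of n] h_nonneg by eventually_elim auto
      show "integrable M (d n)"
        by (rule Bochner_Integration.integrable_bound[OF H[of n] d]) (use dom[of n] assms(2) in auto)
    qed (use min_int H h in auto)
    also have "\<dots> = (LINT x|M. min (d n x) \<bar>h x\<bar>) + (LINT x|M. \<bar>H n x - h x\<bar>)"
      using min_int H h by (intro Bochner_Integration.integral_add) auto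
    finally show ?thesis .
  qed
  then show ?thesis
    by (intro tendsto_sandwich[OF _ _ tendsto_const lim])
       (auto intro!: always_eventually Bochner_Integration.integral_nonneg assms(2))
qed

lemma abs_diff_powr_le:
  fixes a b p :: real
  assumes "0 \<le> p"
  shows "\<bar>a - b\<bar> powr p \<le> 2 powr p * (\<bar>a\<bar> powr p + \<bar>b\<bar> powr p)"
proof -
  have "\<bar>a - b\<bar> powr p \<le> (2 * max \<bar>a\<bar> \<bar>b\<bar>) powr p"
    using assms by (intro powr_mono2) auto
  also have "\<dots> = 2 powr p * (max \<bar>a\<bar> \<bar>b\<bar>) powr p"
    by (rule powr_mult)
  also have "\<dots> \<le> 2 powr p * (\<bar>a\<bar> powr p + \<bar>b\<bar> powr p)"
    by (intro mult_left_mono) (auto simp: max_def)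
  finally show ?thesis .
qed

section \<open>The reversed chain\<close>

locale stationary_markov_path =
  fixes S :: "'a set" and P :: "'a \<Rightarrow> 'a \<Rightarrow> real" and \<pi> :: "'a \<Rightarrow> real"
    and M :: "'a stream measure"
  assumes countable_S: "countable S"
    and stationary: "stationary_markov S P \<pi>"
    and path_measure: "is_markov_path_measure S P \<pi> M"
begin

definition back_prob :: "'a \<Rightarrow> 'a \<Rightarrow> real" where
  "back_prob b a = \<pi> a * P a b / \<pi> b"

definition back_word :: "'a list \<Rightarrow> 'a \<Rightarrow> real" where
  "back_word w b = markov_word P \<pi> (w @ [b]) / \<pi> b"

lemma init_pos: "a \<in> S \<Longrightarrow> 0 < \<pi> a"
  using stationary by (auto simp: stationary_markov_def)

lemma trans_nonneg: "a \<in> S \<Longrightarrow> b \<in> S \<Longrightarrow> 0 \<le> P a b"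
  using stationary by (auto simp: stationary_markov_def)

lemma back_nonneg: "a \<in> S \<Longrightarrow> b \<in> S \<Longrightarrow> 0 \<le> back_prob b a"
  using init_pos[of a] init_pos[of b] trans_nonneg[of a b] by (simp add: back_prob_def)

lemma back_has_sum:
  assumes "b \<in> S" shows "(back_prob b has_sum 1) S"
proof -
  have "((\<lambda>a. \<pi> a * P a b) has_sum \<pi> b) S"
    using stationary assms by (auto simp: stationary_markov_def)
  from has_sum_cmult_left[OF this, of "inverse (\<pi> b)"] show ?thesis
    using init_pos[OF assms] by (simp add: back_prob_def[abs_def] divide_inverse)
qed

lemma back_word_Nil: "b \<in> S \<Longrightarrow> back_word [] b = 1"
  using init_pos[of b] by (simp add: back_word_def markov_word_def)

text \<open>The recursion peels off the last letter of \<open>w\<close>, the one next to the old path: it is the first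
letter that the reversed chain chooses.\<close>

lemma back_word_snoc:
  "a \<in> S \<Longrightarrow> back_word (w @ [a]) b = back_prob b a * back_word w a"
  using init_pos[of a] by (simp add: back_word_def back_prob_def markov_word_snoc)

lemma back_word_nonneg:
  "w \<in> lists S \<Longrightarrow> b \<in> S \<Longrightarrow> 0 \<le> back_word w b"
proof (induction w arbitrary: b rule: rev_induct)
  case (snoc a w)
  then show ?case by (auto simp: back_word_snoc intro!: mult_nonneg_nonneg back_nonneg)
qed (simp add: back_word_Nil)

lemma prob_space_M: "prob_space M"
  using path_measure by (simp add: is_markov_path_measure_def)

lemma sets_M [measurable_cong]: "sets M = sets (stream_space (count_space S))"
  using path_measure by (simp add: is_markov_path_measure_def)

lemma space_M: "space M = streams S"
  using sets_eq_imp_space_eq[OF sets_M] by (simp add: space_stream_space)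

lemma shd_in_S: "x \<in> space M \<Longrightarrow> shd x \<in> S"
  by (simp add: space_M streams_shd)

lemma stl_in_space: "x \<in> space M \<Longrightarrow> stl x \<in> space M"
  by (simp add: space_M streams_stl)

lemma SCons_in_space: "x \<in> space M \<Longrightarrow> a \<in> S \<Longrightarrow> a ## x \<in> space M"
  by (simp add: space_M)

lemma shift_in_space: "w \<in> lists S \<Longrightarrow> x \<in> space M \<Longrightarrow> w @- x \<in> space M"
  by (induction w) (auto simp: SCons_in_space)

lemma back_has_sum_shd: "x \<in> space M \<Longrightarrow> (back_prob (shd x) has_sum 1) S"
  by (simp add: back_has_sum shd_in_S)

sublocale prob_space M
  by (rule prob_space_M)

sublocale letters: sigma_finite_measure "count_space S"
  by (rule sigma_finite_measure_count_space_countable[OF countable_S])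

sublocale letters_pair: pair_sigma_finite M "count_space S" ..

lemma stl_measurable [measurable]: "stl \<in> M \<rightarrow>\<^sub>M M"
  by measurable

lemma shd_measurable [measurable]: "shd \<in> M \<rightarrow>\<^sub>M count_space S"
  by measurable

lemma SCons_measurable [measurable]:
  "(\<lambda>(x, a). a ## x) \<in> M \<Otimes>\<^sub>M count_space S \<rightarrow>\<^sub>M M"
  by measurable

lemma SCons_measurable' [measurable]:
  "a \<in> S \<Longrightarrow> (\<lambda>x. a ## x) \<in> M \<rightarrow>\<^sub>M M"
  by measurable

lemma shift_measurable [measurable]:
  assumes "w \<in> lists S" shows "(\<lambda>x. w @- x) \<in> M \<rightarrow>\<^sub>M M"
  using assms
proof (induction w)
  case (Cons a w)
  then have "(\<lambda>x. a ## x) \<circ> (\<lambda>x. w @- x) \<in> M \<rightarrow>\<^sub>M M"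
    by (intro measurable_comp[of _ _ M]) auto
  then show ?case by (simp add: o_def)
qed simp

text \<open>Any function of the first letter and of a second letter is measurable because \<open>S\<close> is countable.\<close>

lemma measurable_shd_letter:
  "(\<lambda>(x, a). f (shd x) a) \<in> borel_measurable (M \<Otimes>\<^sub>M count_space S)"
proof -
  have [measurable]: "(\<lambda>(b, a). f b a) \<in> borel_measurable (count_space S \<Otimes>\<^sub>M count_space S)"
    by (simp add: pair_measure_countable countable_S)
  show ?thesis
    using measurable_compose[of "\<lambda>(x, a). (shd x, a)" "M \<Otimes>\<^sub>M count_space S" _ "\<lambda>(b, a). f b a"]
    by (simp add: split_beta')
qed

lemmas back_prob_measurable [measurable] = measurable_shd_letter[of back_prob]

lemma emeasure_sstart:
  assumes "w \<in> lists S" shows "emeasure M (sstart S w) = ennreal (markov_word P \<pi> w)"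
proof -
  have "sstart S w = {x \<in> space M. stake (length w) x = w}"
    using assms
  proof (induction w)
    case Nil
    then show ?case by (simp add: space_M)
  next
    case (Cons a w)
    then have IH: "sstart S w = {x \<in> space M. stake (length w) x = w}" and a: "a \<in> S"
      by auto
    show ?case
    proof (rule set_eqI)
      fix x
      have "x \<in> space M \<longleftrightarrow> shd x \<in> S \<and> stl x \<in> space M"
        by (cases x) (simp add: space_M streams_Stream)
      then show "x \<in> sstart S (a # w) \<longleftrightarrow> x \<in> {x \<in> space M. stake (length (a # w)) x = a # w}"
        using a by (auto simp: IH)
    qed
  qed
  then show ?thesis
    using path_measure assms by (simp add: emeasure_eq_measure is_markov_path_measure_def)
qed

section \<open>Prefixing a letter of the reversed chain\<close>

text \<open>The law of \<open>a ## x\<close> when \<open>x\<close> has law \<open>M\<close> and \<open>a\<close> is drawn from \<open>back_prob (shd x)\<close>.\<close>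

definition backward_extension :: "'a stream measure" where
  "backward_extension =
     distr (density (M \<Otimes>\<^sub>M count_space S) (\<lambda>(x, a). ennreal (back_prob (shd x) a))) M (\<lambda>(x, a). a ## x)"

lemma nn_integral_backward_extension:
  assumes [measurable]: "h \<in> borel_measurable M"
  shows "(\<integral>\<^sup>+x. h x \<partial>backward_extension) =
    (\<integral>\<^sup>+x. (\<integral>\<^sup>+a. ennreal (back_prob (shd x) a) * h (a ## x) \<partial>count_space S) \<partial>M)"
proof -
  have "(\<integral>\<^sup>+x. h x \<partial>backward_extension) =
    (\<integral>\<^sup>+z. ennreal (back_prob (shd (fst z)) (snd z)) * h (snd z ## fst z) \<partial>(M \<Otimes>\<^sub>M count_space S))"
    unfolding backward_extension_def
    by (subst nn_integral_distr; (subst nn_integral_density)?) (auto simp: split_beta')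
  also have "\<dots> = (\<integral>\<^sup>+x. (\<integral>\<^sup>+a. ennreal (back_prob (shd x) a) * h (a ## x) \<partial>count_space S) \<partial>M)"
    by (subst letters.nn_integral_fst[symmetric]) (auto simp: split_beta')
  finally show ?thesis .
qed

lemma nn_integral_letter_indicator:
  assumes "b \<in> S"
  shows "(\<integral>\<^sup>+a. g a * indicator {b} a \<partial>count_space S) = (g b :: ennreal)"
  using assms by (subst nn_integral_count_space'[of "{b}"]) auto

lemma sstart_sets [measurable]: "w \<in> lists S \<Longrightarrow> sstart S w \<in> sets M"
  by (auto simp: sets_M sets_stream_space_sstart[OF countable_S] sstart_in_streams image_subset_iff
      simp del: in_lists_conv_set intro!: sigma_sets.Basic)

lemma nn_integral_shd:
  assumes "\<And>b. b \<in> S \<Longrightarrow> 0 \<le> g b"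
  shows "(\<integral>\<^sup>+x. ennreal (g (shd x)) \<partial>M) = (\<integral>\<^sup>+b. ennreal (g b * \<pi> b) \<partial>count_space S)"
proof -
  have "(\<integral>\<^sup>+x. ennreal (g (shd x)) \<partial>M)
      = (\<integral>\<^sup>+x. (\<integral>\<^sup>+b. ennreal (g b) * indicator (sstart S [b]) x \<partial>count_space S) \<partial>M)"
  proof (rule nn_integral_cong)
    fix x assume x: "x \<in> space M"
    have "(\<integral>\<^sup>+b. ennreal (g b) * indicator (sstart S [b]) x \<partial>count_space S) =
       (\<integral>\<^sup>+b. ennreal (g b) * indicator {shd x} b \<partial>count_space S)"
      using stl_in_space[OF x] by (intro nn_integral_cong) (auto simp: indicator_def space_M)
    then show "ennreal (g (shd x)) = (\<integral>\<^sup>+b. ennreal (g b) * indicator (sstart S [b]) x \<partial>count_space S)"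
      using shd_in_S[OF x] by (simp add: nn_integral_letter_indicator)
  qed
  also have "\<dots> = (\<integral>\<^sup>+b. (\<integral>\<^sup>+x. ennreal (g b) * indicator (sstart S [b]) x \<partial>M) \<partial>count_space S)"
  proof (rule letters_pair.Fubini'[symmetric])
    have "(\<lambda>(x, b). ennreal (g b) * indicator {b} (shd x)) \<in> borel_measurable (M \<Otimes>\<^sub>M count_space S)"
      by (rule measurable_shd_letter)
    moreover have "(\<lambda>(x, b). ennreal (g b) * indicator (sstart S [b]) x)
      \<in> borel_measurable (M \<Otimes>\<^sub>M count_space S) \<longleftrightarrow>
      (\<lambda>(x, b). ennreal (g b) * indicator {b} (shd x)) \<in> borel_measurable (M \<Otimes>\<^sub>M count_space S)"
      by (intro measurable_cong)
         (auto simp: space_pair_measure indicator_def space_M streams_stl)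
    ultimately show "(\<lambda>(x, b). ennreal (g b) * indicator (sstart S [b]) x)
      \<in> borel_measurable (M \<Otimes>\<^sub>M count_space S)"
      by simp
  qed
  also have "\<dots> = (\<integral>\<^sup>+b. ennreal (g b * \<pi> b) \<partial>count_space S)"
  proof (rule nn_integral_cong)
    fix b assume "b \<in> space (count_space S)"
    then have b: "b \<in> S" by simp
    then have [measurable]: "sstart S [b] \<in> sets M" by (intro sstart_sets) simp
    show "(\<integral>\<^sup>+x. ennreal (g b) * indicator (sstart S [b]) x \<partial>M) = ennreal (g b * \<pi> b)"
      using b emeasure_sstart[of "[b]"] assms[OF b]
      by (subst nn_integral_cmult_indicator) (auto simp: markov_word_def ennreal_mult')
  qed
  finally show ?thesis .
qed

text \<open>On a cylinder \<open>a b u\<close> the claim is \<open>back_prob b a * m(b u) = m(a b u)\<close>. The cylinder of a single letter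
\<open>a\<close> is different, since the next letter is not determined: there it is the identity
\<open>(\<Sum>b. \<pi> b * back_prob b a) = (\<Sum>b. \<pi> a * P a b) = \<pi> a\<close>.\<close>

lemma emeasure_backward_extension_sstart:
  assumes w: "w \<in> lists S"
  shows "emeasure backward_extension (sstart S w) = emeasure M (sstart S w)"
proof -
  have [measurable]: "sstart S w \<in> sets M" using w by (rule sstart_sets)
  have "emeasure backward_extension (sstart S w) =
     (\<integral>\<^sup>+x. indicator (sstart S w) x \<partial>backward_extension)"
    by (rule nn_integral_indicator[symmetric])
       (simp only: backward_extension_def sets_distr sstart_sets[OF w])
  also have "\<dots> = (\<integral>\<^sup>+x. (\<integral>\<^sup>+a. ennreal (back_prob (shd x) a) * indicator (sstart S w) (a ## x) \<partial>count_space S) \<partial>M)"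
    by (rule nn_integral_backward_extension) simp
  also have "\<dots> = ennreal (markov_word P \<pi> w)"
  proof (cases w)
    case Nil
    have "(\<integral>\<^sup>+a. ennreal (back_prob (shd x) a) * indicator (sstart S w) (a ## x) \<partial>count_space S) = 1"
      if x: "x \<in> space M" for x
    proof -
      have "(\<integral>\<^sup>+a. ennreal (back_prob (shd x) a) * indicator (sstart S w) (a ## x) \<partial>count_space S)
          = (\<integral>\<^sup>+a. ennreal (back_prob (shd x) a) \<partial>count_space S)"
        using x by (intro nn_integral_cong) (auto simp: Nil space_M)
      also have "\<dots> = 1"
        using nn_integral_count_space_has_sum[OF back_has_sum_shd[OF x]] back_nonneg shd_in_S[OF x] by simp
      finally show ?thesis .
    qed
    then show ?thesis
      by (simp add: Nil markov_word_def emeasure_space_1 cong: nn_integral_cong)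
  next
    case (Cons a v)
    then have a: "a \<in> S" and v: "v \<in> lists S" using w by auto
    have [measurable]: "sstart S v \<in> sets M" using v by (rule sstart_sets)
    have "(\<integral>\<^sup>+x. (\<integral>\<^sup>+a. ennreal (back_prob (shd x) a) * indicator (sstart S w) (a ## x) \<partial>count_space S) \<partial>M)
      = (\<integral>\<^sup>+x. ennreal (back_prob (shd x) a) * indicator (sstart S v) x \<partial>M)"
    proof (rule nn_integral_cong)
      fix x assume x: "x \<in> space M"
      have "(\<integral>\<^sup>+a. ennreal (back_prob (shd x) a) * indicator (sstart S w) (a ## x) \<partial>count_space S) =
        (\<integral>\<^sup>+c. (ennreal (back_prob (shd x) c) * indicator (sstart S v) x) * indicator {a} c \<partial>count_space S)"
        by (intro nn_integral_cong) (auto simp: Cons indicator_def)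
      then show "(\<integral>\<^sup>+a. ennreal (back_prob (shd x) a) * indicator (sstart S w) (a ## x) \<partial>count_space S) =
        ennreal (back_prob (shd x) a) * indicator (sstart S v) x"
        using a by (simp add: nn_integral_letter_indicator)
    qed
    also have "\<dots> = ennreal (markov_word P \<pi> w)"
    proof (cases v)
      case Nil
      have "(\<integral>\<^sup>+x. ennreal (back_prob (shd x) a) * indicator (sstart S v) x \<partial>M) =
        (\<integral>\<^sup>+x. ennreal (back_prob (shd x) a) \<partial>M)"
        by (intro nn_integral_cong) (auto simp: Nil space_M)
      also have "\<dots> = (\<integral>\<^sup>+b. ennreal (back_prob b a * \<pi> b) \<partial>count_space S)"
        using a by (intro nn_integral_shd back_nonneg) auto
      also have "\<dots> = (\<integral>\<^sup>+b. ennreal (\<pi> a * P a b) \<partial>count_space S)"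
        by (intro nn_integral_cong) (auto simp: back_prob_def dest: init_pos)
      also have "\<dots> = ennreal (\<pi> a)"
      proof (rule nn_integral_count_space_has_sum)
        have "(P a has_sum 1) S" using stationary a by (auto simp: stationary_markov_def)
        from has_sum_cmult_right[OF this, of "\<pi> a"]
        show "((\<lambda>b. \<pi> a * P a b) has_sum \<pi> a) S" by simp
      qed (use a init_pos[of a] trans_nonneg in auto)
      finally show ?thesis by (simp add: Cons Nil markov_word_def)
    next
      fix b u assume vb: "v = b # u"
      then have b: "b \<in> S" using v by auto
      have "(\<integral>\<^sup>+x. ennreal (back_prob (shd x) a) * indicator (sstart S v) x \<partial>M) =
        (\<integral>\<^sup>+x. ennreal (back_prob b a) * indicator (sstart S v) x \<partial>M)"
        by (intro nn_integral_cong) (auto simp: vb indicator_def)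
      also have "\<dots> = ennreal (back_prob b a) * ennreal (markov_word P \<pi> v)"
        using v by (subst nn_integral_cmult_indicator) (auto simp: emeasure_sstart simp del: in_lists_conv_set)
      also have "\<dots> = ennreal (back_prob b a * markov_word P \<pi> v)"
        using back_nonneg[OF a b] by (simp add: ennreal_mult')
      also have "back_prob b a * markov_word P \<pi> v = markov_word P \<pi> w"
        using init_pos[OF b] markov_word_Cons[of P \<pi> a b u]
        by (simp add: Cons vb back_prob_def field_simps)
      finally show ?thesis .
    qed
    finally show ?thesis .
  qed
  finally show ?thesis
    using w by (simp add: emeasure_sstart del: in_lists_conv_set)
qed

lemma backward_extension_eq: "backward_extension = M"
proof (rule measure_eqI_generator_eq[OF Int_stable_sstart[of S], where \<Omega> = "streams S"
      and A = "\<lambda>_. streams S"])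
  show "sstart S ` lists S \<union> {{}} \<subseteq> Pow (streams S)"
    using sstart_in_streams[of _ S] by blast
  then show sets: "sets M = sigma_sets (streams S) (sstart S ` lists S \<union> {{}})"
    unfolding sets_M sets_stream_space_sstart[OF countable_S] by (rule sets_measure_of)
  show "sets backward_extension = sigma_sets (streams S) (sstart S ` lists S \<union> {{}})"
    unfolding backward_extension_def sets_distr by (rule sets)
  show "emeasure backward_extension X = emeasure M X" if "X \<in> sstart S ` lists S \<union> {{}}" for X
  proof -
    from that consider "X = {}" | w where "w \<in> lists S" "X = sstart S w" by blast
    then show ?thesis by cases (simp_all only: emeasure_backward_extension_sstart emeasure_empty)
  qed
  show "range (\<lambda>_. streams S) \<subseteq> sstart S ` lists S \<union> {{}}"
    using image_eqI[of "streams S" "sstart S" "[]" "lists S"] by simp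
  show "emeasure backward_extension (streams S) \<noteq> \<infinity>"
    using emeasure_backward_extension_sstart[of "[]"] emeasure_finite[of "streams S"] by simp
qed simp

section \<open>The transfer operator\<close>

definition transfer :: "('a stream \<Rightarrow> real) \<Rightarrow> 'a stream \<Rightarrow> real" where
  "transfer h x = (\<Sum>\<^sub>\<infinity>a\<in>S. back_prob (shd x) a * h (a ## x))"

text \<open>Marks the points at which \<open>transfer h\<close> is a genuine sum and not the default value \<open>0\<close>.\<close>

definition transferable :: "('a stream \<Rightarrow> real) \<Rightarrow> 'a stream \<Rightarrow> bool" where
  "transferable h x \<longleftrightarrow> (\<lambda>a. back_prob (shd x) a * h (a ## x)) summable_on S"

text \<open>A step of the reversed chain from an \<open>M\<close>-typical path cannot lead into a null set, since the prefixed path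
again has law \<open>M\<close>.\<close>

lemma AE_backward:
  assumes "AE x in M. Q x"
  shows "AE x in M. \<forall>a\<in>S. back_prob (shd x) a \<noteq> 0 \<longrightarrow> Q (a ## x)"
proof -
  have "AE x in backward_extension. Q x"
    unfolding backward_extension_eq by (rule assms)
  then have "AE z in M \<Otimes>\<^sub>M count_space S. 0 < ennreal (back_prob (shd (fst z)) (snd z)) \<longrightarrow> Q (snd z ## fst z)"
    unfolding backward_extension_def
    by (auto dest!: AE_distrD[rotated] simp: AE_density split_beta')
  then have "AE x in M. AE a in count_space S. 0 < back_prob (shd x) a \<longrightarrow> Q (a ## x)"
    by (auto dest!: letters_pair.AE_pair)
  then show ?thesis
    using AE_space
  proof eventually_elim
    case (elim x)
    then show ?case
      using back_nonneg[OF _ shd_in_S[of x]] by (force simp: AE_count_space)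
  qed
qed

lemma AE_backward_word:
  assumes "AE x in M. Q x" and w: "w \<in> lists S"
  shows "AE x in M. back_word w (shd x) \<noteq> 0 \<longrightarrow> Q (w @- x)"
  using w
proof (induction w rule: rev_induct)
  case Nil
  from assms(1) show ?case by eventually_elim simp
next
  case (snoc a w)
  then have a: "a \<in> S" and "AE x in M. back_word w (shd x) \<noteq> 0 \<longrightarrow> Q (w @- x)" by auto
  from AE_backward[OF this(2)] show ?case
    by eventually_elim (use a in \<open>simp add: back_word_snoc\<close>)
qed

text \<open>There are only countably many words, so the null sets of the individual words may be collected. This
is what allows pointwise inductions along trees: at almost every \<open>x\<close> the inductive hypotheses hold at
all points that the reversed chain can reach from \<open>x\<close>.\<close>

lemma AE_backward_words:
  assumes "AE x in M. Q x"
  shows "AE x in M. \<forall>w\<in>lists S. back_word w (shd x) \<noteq> 0 \<longrightarrow> Q (w @- x)"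
  using AE_backward_word[OF assms] by (intro AE_ball_countable[THEN iffD2]) (auto simp: countable_S)

text \<open>The shift preserves \<open>M\<close> because it undoes the prefixing of a letter, and the backward probabilities sum
to \<open>1\<close>.\<close>

lemma nn_integral_stl:
  assumes [measurable]: "h \<in> borel_measurable M"
  shows "(\<integral>\<^sup>+x. h (stl x) \<partial>M) = (\<integral>\<^sup>+x. h x \<partial>M)"
proof -
  have "(\<integral>\<^sup>+x. h (stl x) \<partial>M) = (\<integral>\<^sup>+x. h (stl x) \<partial>backward_extension)"
    by (simp add: backward_extension_eq)
  also have "\<dots> = (\<integral>\<^sup>+x. (\<integral>\<^sup>+a. ennreal (back_prob (shd x) a) * h x \<partial>count_space S) \<partial>M)"
    by (subst nn_integral_backward_extension) auto
  also have "\<dots> = (\<integral>\<^sup>+x. h x \<partial>M)"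
  proof (rule nn_integral_cong)
    fix x assume x: "x \<in> space M"
    have "(\<integral>\<^sup>+a. ennreal (back_prob (shd x) a) \<partial>count_space S) = 1"
      using nn_integral_count_space_has_sum[OF back_has_sum_shd[OF x]] back_nonneg shd_in_S[OF x] by simp
    then show "(\<integral>\<^sup>+a. ennreal (back_prob (shd x) a) * h x \<partial>count_space S) = h x"
      by (simp add: nn_integral_multc)
  qed
  finally show ?thesis .
qed

lemma distr_stl: "distr M M stl = M"
proof (rule measure_eqI)
  fix A assume A: "A \<in> sets (distr M M stl)"
  then have [measurable]: "A \<in> sets M" by simp
  have "emeasure (distr M M stl) A = (\<integral>\<^sup>+x. indicator A x \<partial>distr M M stl)"
    using A by simp
  also have "\<dots> = (\<integral>\<^sup>+x. indicator A (stl x) \<partial>M)"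
    by (rule nn_integral_distr) simp_all
  finally show "emeasure (distr M M stl) A = emeasure M A"
    by (simp add: nn_integral_stl)
qed simp

lemma AE_stl: "AE x in M. Q x \<Longrightarrow> AE x in M. Q (stl x)"
  using AE_distrD[OF stl_measurable, of Q] unfolding distr_stl .

text \<open>Converse of \<open>AE_backward\<close>: as \<open>M\<close> is the law of the prefixed path, a property that is almost surely
inherited by every possible prefixed path holds almost surely.\<close>

lemma AE_backwardD:
  assumes [measurable]: "Measurable.pred M Q"
    and "AE x in M. \<forall>a\<in>S. back_prob (shd x) a \<noteq> 0 \<longrightarrow> Q (a ## x)"
  shows "AE x in M. Q x"
proof -
  have "(\<integral>\<^sup>+x. indicator {x\<in>space M. \<not> Q x} x \<partial>M) =
    (\<integral>\<^sup>+x. indicator {x\<in>space M. \<not> Q x} x \<partial>backward_extension)"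
    by (simp add: backward_extension_eq)
  also have "\<dots> = (\<integral>\<^sup>+x. (\<integral>\<^sup>+a. ennreal (back_prob (shd x) a) * indicator {x\<in>space M. \<not> Q x} (a ## x) \<partial>count_space S) \<partial>M)"
    by (rule nn_integral_backward_extension) measurable
  also have "\<dots> = (\<integral>\<^sup>+x. 0 \<partial>M)"
    using assms(2)
  proof (intro nn_integral_cong_AE, eventually_elim)
    case (elim x)
    then have "(\<integral>\<^sup>+a. ennreal (back_prob (shd x) a) * indicator {x\<in>space M. \<not> Q x} (a ## x) \<partial>count_space S)
      = (\<integral>\<^sup>+a. 0 \<partial>count_space S)"
      by (intro nn_integral_cong) (auto simp: indicator_def)
    then show ?case by simp
  qed
  finally have "emeasure M {x\<in>space M. \<not> Q x} = 0"
    by simp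
  then show ?thesis
    by (subst AE_iff_measurable[OF _ refl]) auto
qed

context
  fixes h :: "'a stream \<Rightarrow> real"
  assumes h: "integrable M h"
begin

lemma integrable_pair_transfer:
  "integrable (M \<Otimes>\<^sub>M count_space S) (\<lambda>z. back_prob (shd (fst z)) (snd z) * h (snd z ## fst z))" (is ?I)
  "(LINT z|(M \<Otimes>\<^sub>M count_space S). back_prob (shd (fst z)) (snd z) * h (snd z ## fst z)) = (LINT x|M. h x)" (is ?E)
proof -
  have [measurable]: "h \<in> borel_measurable M" using h by simp
  have nonneg: "AE z in M \<Otimes>\<^sub>M count_space S. 0 \<le> back_prob (shd (fst z)) (snd z)"
    by (rule AE_I2) (auto simp: space_pair_measure intro!: back_nonneg shd_in_S)
  have m: "(\<lambda>z. snd z ## fst z) \<in> density (M \<Otimes>\<^sub>M count_space S) (\<lambda>z. ennreal (back_prob (shd (fst z)) (snd z))) \<rightarrow>\<^sub>M M"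
    using SCons_measurable by (simp add: split_beta')
  have "integrable backward_extension h" using h by (simp add: backward_extension_eq)
  then show ?I
    unfolding backward_extension_def using nonneg
    by (simp add: split_beta' integrable_distr_eq[OF m] integrable_density)
  have "(LINT x|M. h x) = (LINT x|backward_extension. h x)"
    by (simp add: backward_extension_eq)
  also have "\<dots> = (LINT z|(M \<Otimes>\<^sub>M count_space S). back_prob (shd (fst z)) (snd z) * h (snd z ## fst z))"
    unfolding backward_extension_def using nonneg
    by (simp add: split_beta' integral_distr[OF m] integral_density)
  finally show ?E ..
qed

lemma AE_transferable: "AE x in M. transferable h x"
  using letters_pair.AE_integrable_fst'[OF integrable_pair_transfer(1)]
  by (simp add: transferable_def summable_on_iff_integrable_count_space)

lemma integrable_transfer: "integrable M (transfer h)"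
  using letters_pair.integrable_fst'[OF integrable_pair_transfer(1)]
  by (simp add: transfer_def[abs_def] infsum_eq_integral_count_space)

lemma integral_transfer: "(LINT x|M. transfer h x) = (LINT x|M. h x)"
  using letters_pair.integral_fst'[OF integrable_pair_transfer(1)] integrable_pair_transfer(2)
  by (simp add: transfer_def[abs_def] infsum_eq_integral_count_space)

end

lemma transfer_stl_mult: "transfer (\<lambda>y. g (stl y) * h y) x = g x * transfer h x"
proof -
  have "transfer (\<lambda>y. g (stl y) * h y) x = (\<Sum>\<^sub>\<infinity>a\<in>S. g x * (back_prob (shd x) a * h (a ## x)))"
    unfolding transfer_def by (intro infsum_cong) simp
  then show ?thesis
    by (simp add: transfer_def infsum_cmult_right')
qed

text \<open>The transfer operator is adjoint to composition with the shift.\<close>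

lemma integral_indicator_transfer:
  assumes [measurable]: "A \<in> sets M" and h: "integrable M h"
  shows "(LINT x|M. indicator A x * transfer h x) = (LINT x|M. indicator A (stl x) * h x)"
proof -
  have "integrable M (\<lambda>x. h x * indicator (stl -` A \<inter> space M) x)"
    by (intro integrable_real_mult_indicator h) simp
  then have "integrable M (\<lambda>x. indicator A (stl x) * h x)"
    by (rule Bochner_Integration.integrable_cong[THEN iffD1, OF refl, rotated]) (auto simp: indicator_def)
  from integral_transfer[OF this] show ?thesis
    by (simp add: transfer_stl_mult)
qed

lemma transfer_nonneg:
  assumes "x \<in> space M" "\<And>y. 0 \<le> h y"
  shows "0 \<le> transfer h x"
  unfolding transfer_def
  by (intro infsum_nonneg mult_nonneg_nonneg back_nonneg) (auto simp: assms shd_in_S)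

lemma transfer_ge_term:
  assumes "x \<in> space M" "a \<in> S" "transferable h x" "\<And>y. 0 \<le> h y"
  shows "back_prob (shd x) a * h (a ## x) \<le> transfer h x"
  unfolding transfer_def
  using finite_sum_le_infsum[of "\<lambda>a. back_prob (shd x) a * h (a ## x)" S "{a}"] assms
  by (auto simp: transferable_def intro!: mult_nonneg_nonneg back_nonneg shd_in_S)

lemma transfer_mono:
  assumes "x \<in> space M" "transferable g x" "transferable h x"
    "\<And>a. a \<in> S \<Longrightarrow> back_prob (shd x) a \<noteq> 0 \<Longrightarrow> g (a ## x) \<le> h (a ## x)"
  shows "transfer g x \<le> transfer h x"
  unfolding transfer_def
proof (rule infsum_mono)
  fix a assume "a \<in> S"
  then show "back_prob (shd x) a * g (a ## x) \<le> back_prob (shd x) a * h (a ## x)"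
    using assms(4)[of a] back_nonneg[of a "shd x"] shd_in_S[OF assms(1)]
    by (cases "back_prob (shd x) a = 0") (auto intro: mult_left_mono)
qed (use assms in \<open>auto simp: transferable_def\<close>)

section \<open>Sums over trees\<close>

definition tree_sum :: "('a stream \<Rightarrow> real) \<Rightarrow> 'a list set \<Rightarrow> 'a stream \<Rightarrow> real" where
  "tree_sum f \<tau> x = (\<Sum>\<^sub>\<infinity>w\<in>\<tau>. back_word w (shd x) * f (w @- x))"

definition tree_summable :: "('a stream \<Rightarrow> real) \<Rightarrow> 'a list set \<Rightarrow> 'a stream \<Rightarrow> bool" where
  "tree_summable f \<tau> x \<longleftrightarrow> (\<lambda>w. back_word w (shd x) * f (w @- x)) summable_on \<tau>"

text \<open>The part of \<open>\<tau>\<close> that the reversed chain still has to explore after choosing the letter \<open>a\<close>. It is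
empty when \<open>\<tau>\<close> stops there.\<close>

definition branch :: "'a list set \<Rightarrow> 'a \<Rightarrow> 'a list set" where
  "branch \<tau> a = {w. w @ [a] \<in> \<tau>}"

lemma tree_decomp:
  assumes "[] \<in> \<tau>" "\<tau> \<subseteq> lists S"
  shows "\<tau> = insert [] ((\<lambda>(a, w). w @ [a]) ` Sigma S (branch \<tau>))"
proof (intro set_eqI iffI)
  fix v assume "v \<in> \<tau>"
  then show "v \<in> insert [] ((\<lambda>(a, w). w @ [a]) ` Sigma S (branch \<tau>))"
    using assms by (cases v rule: rev_cases) (auto simp: branch_def image_iff)
qed (use assms in \<open>auto simp: branch_def\<close>)

lemma inj_snoc: "inj_on (\<lambda>(a, w). w @ [a]) A"
  by (auto simp: inj_on_def)

lemma tree_summable_iff_Sigma: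
  assumes "[] \<in> \<tau>" "\<tau> \<subseteq> lists S"
  shows "tree_summable f \<tau> x \<longleftrightarrow>
    (\<lambda>(a, w). back_prob (shd x) a * (back_word w a * f (w @- (a ## x)))) summable_on Sigma S (branch \<tau>)"
proof -
  have "tree_summable f \<tau> x \<longleftrightarrow> ((\<lambda>w. back_word w (shd x) * f (w @- x)) \<circ> (\<lambda>(a, w). w @ [a])) summable_on Sigma S (branch \<tau>)"
    unfolding tree_summable_def
    by (subst tree_decomp[OF assms])
       (simp add: summable_on_insert_iff summable_on_reindex[OF inj_snoc])
  also have "\<dots> \<longleftrightarrow> (\<lambda>(a, w). back_prob (shd x) a * (back_word w a * f (w @- (a ## x)))) summable_on Sigma S (branch \<tau>)"
    by (intro summable_on_cong) (auto simp: back_word_snoc shift_append)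
  finally show ?thesis .
qed

text \<open>Conditioning on the first step of the reversed chain: the empty word contributes \<open>f x\<close>, and the words
ending in \<open>a\<close> contribute the sum over \<open>branch \<tau> a\<close> at \<open>a ## x\<close>.\<close>

lemma tree_sum_rec:
  assumes "[] \<in> \<tau>" "\<tau> \<subseteq> lists S" "tree_summable f \<tau> x" and x: "x \<in> space M"
  shows "tree_sum f \<tau> x = f x + (\<Sum>\<^sub>\<infinity>a\<in>S. back_prob (shd x) a * tree_sum f (branch \<tau> a) (a ## x))" (is ?E)
    and "(\<lambda>a. back_prob (shd x) a * tree_sum f (branch \<tau> a) (a ## x)) summable_on S" (is ?S)
proof -
  let ?g = "\<lambda>a w. back_prob (shd x) a * (back_word w a * f (w @- (a ## x)))"
  let ?T = "(\<lambda>(a, w). w @ [a]) ` Sigma S (branch \<tau>)"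
  have sum: "(\<lambda>(a, w). ?g a w) summable_on Sigma S (branch \<tau>)"
    using assms by (simp add: tree_summable_iff_Sigma)
  have inner: "infsum (?g a) (branch \<tau> a) = back_prob (shd x) a * tree_sum f (branch \<tau> a) (a ## x)" for a
    by (simp add: tree_sum_def infsum_cmult_right')
  show ?S
    using summable_on_Sigma_banach[OF sum] by (simp add: inner)
  have "(\<lambda>w. back_word w (shd x) * f (w @- x)) summable_on ?T"
    using assms(3) unfolding tree_summable_def
    by (subst (asm) tree_decomp[OF assms(1,2)]) (simp add: summable_on_insert_iff)
  then have "tree_sum f \<tau> x = f x + (\<Sum>\<^sub>\<infinity>w\<in>?T. back_word w (shd x) * f (w @- x))"
    unfolding tree_sum_def
    by (subst tree_decomp[OF assms(1,2)], subst infsum_insert)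
       (auto simp: back_word_Nil shd_in_S[OF x])
  also have "(\<Sum>\<^sub>\<infinity>w\<in>?T. back_word w (shd x) * f (w @- x)) = (\<Sum>\<^sub>\<infinity>(a, w)\<in>Sigma S (branch \<tau>). ?g a w)"
    by (subst infsum_reindex[OF inj_snoc], intro infsum_cong) (auto simp: back_word_snoc shift_append)
  also have "\<dots> = (\<Sum>\<^sub>\<infinity>a\<in>S. back_prob (shd x) a * tree_sum f (branch \<tau> a) (a ## x))"
    using infsum_Sigma'_banach[OF sum] by (simp add: inner)
  finally show ?E .
qed

lemma tree_summable_subset:
  "tree_summable f \<tau> x \<Longrightarrow> \<tau>' \<subseteq> \<tau> \<Longrightarrow> tree_summable f \<tau>' x"
  unfolding tree_summable_def by (rule summable_on_subset_banach)

lemma words_le_subset_lists: "words_le S n \<subseteq> lists S"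
  by (auto simp: words_le_def)

lemma Nil_in_words_le: "[] \<in> words_le S n"
  by (simp add: words_le_def)

lemma branch_words_le_Suc: "a \<in> S \<Longrightarrow> branch (words_le S (Suc n)) a = words_le S n"
  by (auto simp: branch_def words_le_def)

text \<open>For nonnegative \<open>f\<close>, summability of the iterated sums suffices for summability over the words of the next
length. Letters of probability \<open>0\<close> are excluded from the hypothesis because almost sure statements
say nothing about the points they lead to.\<close>

lemma tree_summable_words_le_Suc:
  assumes x: "x \<in> space M" and f: "\<And>y. 0 \<le> f y"
    and "\<And>a. a \<in> S \<Longrightarrow> back_prob (shd x) a \<noteq> 0 \<Longrightarrow> tree_summable f (words_le S n) (a ## x)"
    and "transferable (tree_sum f (words_le S n)) x"
  shows "tree_summable f (words_le S (Suc n)) x"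
  unfolding tree_summable_iff_Sigma[OF Nil_in_words_le words_le_subset_lists]
proof (rule summable_on_SigmaI)
  show "(\<lambda>a. back_prob (shd x) a * tree_sum f (words_le S n) (a ## x)) summable_on S"
    using assms(4) by (simp add: transferable_def)
next
  fix a assume a: "a \<in> S"
  show "((\<lambda>w. case (a, w) of (a, w) \<Rightarrow> back_prob (shd x) a * (back_word w a * f (w @- a ## x)))
    has_sum back_prob (shd x) a * tree_sum f (words_le S n) (a ## x)) (branch (words_le S (Suc n)) a)"
  proof (cases "back_prob (shd x) a = 0")
    case False
    with assms(3)[OF a] show ?thesis
      by (auto simp: branch_words_le_Suc[OF a] tree_sum_def tree_summable_def intro!: has_sum_cmult_right)
  qed simp
next
  fix a w assume a: "a \<in> S" and "w \<in> branch (words_le S (Suc n)) a"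
  then have "w \<in> lists S"
    using words_le_subset_lists by (auto simp: branch_words_le_Suc)
  with a show "0 \<le> (case (a, w) of (a, w) \<Rightarrow> back_prob (shd x) a * (back_word w a * f (w @- a ## x)))"
    by (auto simp: shd_in_S[OF x] f intro!: mult_nonneg_nonneg back_nonneg back_word_nonneg)
qed

lemma tree_sum_measurable:
  assumes [measurable]: "f \<in> borel_measurable M" and \<tau>: "\<tau> \<subseteq> lists S"
  shows "tree_sum f \<tau> \<in> borel_measurable M"
proof -
  have c: "countable \<tau>"
    using \<tau> countable_subset[of \<tau> "lists S"] countable_S by auto
  have "(\<lambda>(w, x). back_word w (shd x) * f (w @- x)) \<in> borel_measurable (count_space \<tau> \<Otimes>\<^sub>M M)"
  proof (rule measurable_pair_measure_countable1[OF c])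
    fix w assume "w \<in> \<tau>"
    then have [measurable]: "(\<lambda>x. w @- x) \<in> M \<rightarrow>\<^sub>M M" using \<tau> by (intro shift_measurable) auto
    have [measurable]: "(\<lambda>x. back_word w (shd x)) \<in> borel_measurable M"
      by (rule measurable_compose[OF shd_measurable]) simp
    show "(\<lambda>x. case (w, x) of (w, x) \<Rightarrow> back_word w (shd x) * f (w @- x)) \<in> borel_measurable M"
      by simp
  qed
  from measurable_pair_swap[OF this]
  have "(\<lambda>(x, w). back_word w (shd x) * f (w @- x)) \<in> borel_measurable (M \<Otimes>\<^sub>M count_space \<tau>)"
    by simp
  from sigma_finite_measure.borel_measurable_lebesgue_integral[OF sigma_finite_measure_count_space_countable[OF c] this]
  show ?thesis
    by (simp add: tree_sum_def[abs_def] infsum_eq_integral_count_space)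
qed

lemma tree_sum_words_le_Suc:
  assumes "tree_summable f (words_le S (Suc n)) x" "x \<in> space M"
  shows "tree_sum f (words_le S (Suc n)) x = f x + transfer (tree_sum f (words_le S n)) x"
  using tree_sum_rec(1)[OF Nil_in_words_le words_le_subset_lists assms]
  unfolding transfer_def by (simp add: branch_words_le_Suc cong: infsum_cong)

lemma tree_sum_words_le_0: "x \<in> space M \<Longrightarrow> tree_sum f (words_le S 0) x = f x"
  by (simp add: words_le_0 tree_sum_def back_word_Nil shd_in_S)

lemma tree_summable_words_le_0: "tree_summable f (words_le S 0) x"
  by (simp add: words_le_0 tree_summable_def)

lemma tree_sum_words_le_step:
  assumes f: "integrable M f"
    and int: "integrable M (tree_sum f (words_le S n))"
      "(LINT x|M. tree_sum f (words_le S n) x) = real (n + 1) * (LINT x|M. f x)"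
    and sum: "AE x in M. tree_summable f (words_le S (Suc n)) x"
  shows "integrable M (tree_sum f (words_le S (Suc n)))"
    "(LINT x|M. tree_sum f (words_le S (Suc n)) x) = real (Suc n + 1) * (LINT x|M. f x)"
proof -
  let ?g = "\<lambda>x. f x + transfer (tree_sum f (words_le S n)) x"
  have ae: "AE x in M. tree_sum f (words_le S (Suc n)) x = ?g x"
    using sum AE_space by eventually_elim (rule tree_sum_words_le_Suc)
  have g: "integrable M ?g"
    using f integrable_transfer[OF int(1)] by simp
  have meas: "tree_sum f (words_le S (Suc n)) \<in> borel_measurable M"
    using f by (intro tree_sum_measurable words_le_subset_lists) simp
  show "integrable M (tree_sum f (words_le S (Suc n)))"
    using integrable_cong_AE[OF meas borel_measurable_integrable[OF g] ae] g by simp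
  have "(LINT x|M. tree_sum f (words_le S (Suc n)) x) = (LINT x|M. ?g x)"
    by (rule integral_cong_AE[OF meas borel_measurable_integrable[OF g] ae])
  also have "\<dots> = (LINT x|M. f x) + real (n + 1) * (LINT x|M. f x)"
    by (simp add: f integrable_transfer[OF int(1)] integral_transfer[OF int(1)] int(2))
  finally show "(LINT x|M. tree_sum f (words_le S (Suc n)) x) = real (Suc n + 1) * (LINT x|M. f x)"
    by (simp add: algebra_simps)
qed

lemma tree_sum_words_le_0_integral:
  assumes f: "integrable M f"
  shows "integrable M (tree_sum f (words_le S 0))"
    "(LINT x|M. tree_sum f (words_le S 0) x) = real (0 + 1) * (LINT x|M. f x)"
proof -
  show "integrable M (tree_sum f (words_le S 0))"
    by (rule Bochner_Integration.integrable_cong[THEN iffD1, OF refl _ f]) (simp add: tree_sum_words_le_0)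
  show "(LINT x|M. tree_sum f (words_le S 0) x) = real (0 + 1) * (LINT x|M. f x)"
    by (simp add: tree_sum_words_le_0 cong: Bochner_Integration.integral_cong)
qed

text \<open>The sum over \<open>words_le S n\<close> is \<open>f + T f + \<dots> + T\<^sup>n f\<close>, so its integral is \<open>n + 1\<close> times that of \<open>f\<close>.
Finiteness almost everywhere at height \<open>n + 1\<close> needs integrability at height \<open>n\<close>, and so the three
statements are proved by a joint induction.\<close>

lemma AE_tree_summable_nonneg:
  assumes f: "integrable M f" "\<And>y. 0 \<le> f y"
  shows "(AE x in M. tree_summable f (words_le S n) x) \<and> integrable M (tree_sum f (words_le S n)) \<and>
    (LINT x|M. tree_sum f (words_le S n) x) = real (n + 1) * (LINT x|M. f x)"
proof (induction n)
  case 0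
  then show ?case
    using tree_sum_words_le_0_integral[OF f(1)] by (simp add: tree_summable_words_le_0)
next
  case (Suc n)
  then have int: "integrable M (tree_sum f (words_le S n))"
      "(LINT x|M. tree_sum f (words_le S n) x) = real (n + 1) * (LINT x|M. f x)"
    and ae: "AE x in M. tree_summable f (words_le S n) x" by auto
  have sum: "AE x in M. tree_summable f (words_le S (Suc n)) x"
    using AE_backward[OF ae] AE_transferable[OF int(1)] AE_space
    by eventually_elim (rule tree_summable_words_le_Suc, use f in auto)
  show ?case
    using sum tree_sum_words_le_step[OF f(1) int sum] by blast
qed

text \<open>Words of bounded length contain every tree of bounded height, so one null set serves all the
(possibly uncountably many) trees.\<close>

lemma AE_tree_summable:
  assumes f: "integrable M f"
  shows "AE x in M. \<forall>n. tree_summable f (words_le S n) x"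
proof -
  have "AE x in M. \<forall>n. tree_summable (\<lambda>x. \<bar>f x\<bar>) (words_le S n) x"
    using AE_tree_summable_nonneg[of "\<lambda>x. \<bar>f x\<bar>"] f by (simp add: AE_all_countable)
  then show ?thesis
    using AE_space
  proof eventually_elim
    case (elim x)
    show ?case
    proof
      fix n
      have "(\<lambda>w. norm (back_word w (shd x) * f (w @- x))) summable_on words_le S n \<longleftrightarrow>
         (\<lambda>w. back_word w (shd x) * \<bar>f (w @- x)\<bar>) summable_on words_le S n"
        using back_word_nonneg[OF _ shd_in_S[OF elim(2)]]
        by (intro summable_on_cong) (auto simp: abs_mult words_le_def)
      then show "tree_summable f (words_le S n) x"
        using elim(1) unfolding tree_summable_def by (metis abs_summable_summable)
    qed
  qed
qed

lemma integral_tree_sum_words_le: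
  assumes f: "integrable M f"
  shows "integrable M (tree_sum f (words_le S n))"
    "(LINT x|M. tree_sum f (words_le S n) x) = real (n + 1) * (LINT x|M. f x)"
proof (induction n)
  case 0
  { case 1 then show ?case using tree_sum_words_le_0_integral[OF f] by simp }
  { case 2 then show ?case using tree_sum_words_le_0_integral[OF f] by simp }
next
  case (Suc n)
  have "AE x in M. tree_summable f (words_le S (Suc n)) x"
    using AE_tree_summable[OF f] by eventually_elim simp
  note step = tree_sum_words_le_step[OF f Suc this]
  { case 1 then show ?case using step by simp }
  { case 2 then show ?case using step by simp }
qed

section \<open>Trees as stopping rules and the maximal inequality\<close>

text \<open>The dynamic programming equation for the largest sum over trees of height at most \<open>n\<close>: continue with a
letter exactly if the best sum that can still be collected behind it is positive. The equation is
taken as the definition since it makes measurability and integrability evident; the supremum is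
identified in \<open>tree_sum_le_best_sum\<close> and \<open>tree_sum_best_tree\<close>.\<close>

primrec best_sum :: "('a stream \<Rightarrow> real) \<Rightarrow> nat \<Rightarrow> 'a stream \<Rightarrow> real" where
  "best_sum f 0 = f"
| "best_sum f (Suc n) = (\<lambda>x. f x + transfer (\<lambda>y. max 0 (best_sum f n y)) x)"

lemma integrable_best_sum: "integrable M f \<Longrightarrow> integrable M (best_sum f n)"
  by (induction n) (auto intro!: integrable_transfer integrable_max)

lemma integrable_max_best_sum: "integrable M f \<Longrightarrow> integrable M (\<lambda>y. max 0 (best_sum f n y))"
  by (intro integrable_max integrable_best_sum) simp

text \<open>Convergence of the sums in the two recursions, the one for tree sums and the one for \<open>best_sum\<close>, so that
they may be compared term by term at \<open>x\<close>.\<close>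

definition regular :: "('a stream \<Rightarrow> real) \<Rightarrow> 'a stream \<Rightarrow> bool" where
  "regular f x \<longleftrightarrow> (\<forall>n. tree_summable f (words_le S n) x) \<and>
     (\<forall>n. transferable (\<lambda>y. max 0 (best_sum f n y)) x)"

text \<open>Regularity at all points reachable from \<open>x\<close>, hence a property inherited under steps of the reversed chain;
the empty word shows that \<open>x\<close> itself is regular.\<close>

definition backward_regular :: "('a stream \<Rightarrow> real) \<Rightarrow> 'a stream \<Rightarrow> bool" where
  "backward_regular f x \<longleftrightarrow> x \<in> space M \<and>
     (\<forall>w\<in>lists S. back_word w (shd x) \<noteq> 0 \<longrightarrow> regular f (w @- x))"

lemma AE_backward_regular:
  assumes "integrable M f" shows "AE x in M. backward_regular f x"
proof -
  have "AE x in M. \<forall>n. transferable (\<lambda>y. max 0 (best_sum f n y)) x"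
    using AE_transferable[OF integrable_max_best_sum[OF assms]] by (simp add: AE_all_countable)
  with AE_tree_summable[OF assms] have "AE x in M. regular f x"
    by eventually_elim (simp add: regular_def)
  from AE_backward_words[OF this] AE_space show ?thesis
    by eventually_elim (simp add: backward_regular_def)
qed

lemma backward_regularD:
  assumes "backward_regular f x"
  shows "x \<in> space M" "tree_summable f (words_le S n) x"
    "transferable (\<lambda>y. max 0 (best_sum f n y)) x"
  using assms back_word_Nil[OF shd_in_S, of x]
  by (force simp: backward_regular_def regular_def dest!: bspec[of _ _ "[]"])+

lemma backward_regular_SCons:
  assumes "backward_regular f x" "a \<in> S" "back_prob (shd x) a \<noteq> 0"
  shows "backward_regular f (a ## x)"
  unfolding backward_regular_def
proof (intro conjI ballI impI)
  show "a ## x \<in> space M"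
    using assms by (simp add: backward_regular_def SCons_in_space)
  fix w assume "w \<in> lists S" "back_word w (shd (a ## x)) \<noteq> 0"
  then have "w @ [a] \<in> lists S" "back_word (w @ [a]) (shd x) \<noteq> 0"
    using assms by (auto simp: back_word_snoc)
  then have "regular f ((w @ [a]) @- x)"
    using assms(1) unfolding backward_regular_def by blast
  then show "regular f (w @- a ## x)" by simp
qed

lemma best_sum_le_Suc:
  assumes "backward_regular f x"
  shows "best_sum f n x \<le> best_sum f (Suc n) x"
  using assms
proof (induction n arbitrary: x)
  case 0
  then show ?case
    using backward_regularD(1)[OF 0] transfer_nonneg[of x "\<lambda>y. max 0 (f y)"] by simp
next
  case (Suc n)
  have "transfer (\<lambda>y. max 0 (best_sum f n y)) x \<le> transfer (\<lambda>y. max 0 (best_sum f (Suc n) y)) x"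
  proof (rule transfer_mono)
    fix a assume "a \<in> S" "back_prob (shd x) a \<noteq> 0"
    then show "max 0 (best_sum f n (a ## x)) \<le> max 0 (best_sum f (Suc n) (a ## x))"
      using Suc.IH[OF backward_regular_SCons[OF Suc.prems]] by (intro max.mono) auto
  qed (use backward_regularD[OF Suc.prems] in blast)+
  then show ?case by simp
qed

lemma best_sum_mono:
  assumes "backward_regular f x" "m \<le> n"
  shows "best_sum f m x \<le> best_sum f n x"
  using lift_Suc_mono_le[of "\<lambda>n. best_sum f n x", OF best_sum_le_Suc[OF assms(1)] assms(2)] .

lemma branch_in_trees:
  assumes "\<tau> \<in> trees S" "branch \<tau> a \<noteq> {}"
  shows "branch \<tau> a \<in> trees S"
proof -
  obtain n where "\<tau> \<subseteq> words_le S n" and suffix: "\<And>t1 t2. t1 @ t2 \<in> \<tau> \<Longrightarrow> t2 \<in> \<tau>"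
    using assms(1) by (auto simp: trees_def)
  then have "branch \<tau> a \<subseteq> words_le S n"
    by (fastforce simp: branch_def words_le_def)
  moreover have "[] \<in> branch \<tau> a"
    using assms(2) suffix[of _ "[a]"] by (auto simp: branch_def)
  moreover have "t2 \<in> branch \<tau> a" if "t1 @ t2 \<in> branch \<tau> a" for t1 t2
    using that suffix[of t1 "t2 @ [a]"] by (simp add: branch_def)
  ultimately show ?thesis
    unfolding trees_def by blast
qed

lemma tree_sum_empty: "tree_sum f {} x = 0"
  by (simp add: tree_sum_def)

text \<open>Each branch is either empty and contributes \<open>0\<close>, or is a tree of smaller height, whose sum is at most
\<open>best_sum f n\<close>. In both cases the positive part of \<open>best_sum f n\<close> bounds it.\<close>

lemma tree_sum_le_best_sum:
  assumes "\<tau> \<in> trees S" "\<tau> \<subseteq> words_le S n" "backward_regular f x"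
  shows "tree_sum f \<tau> x \<le> best_sum f n x"
  using assms
proof (induction n arbitrary: \<tau> x)
  case 0
  then have "\<tau> = words_le S 0" by (auto simp: words_le_0 trees_def)
  then show ?case using backward_regularD(1)[OF 0(3)] by (simp add: tree_sum_words_le_0)
next
  case (Suc n)
  note x = backward_regularD[OF Suc.prems(3)]
  have \<tau>: "[] \<in> \<tau>" "\<tau> \<subseteq> lists S" "tree_summable f \<tau> x"
    using Suc.prems words_le_subset_lists tree_summable_subset[OF x(2) Suc.prems(2)]
    by (auto simp: trees_def)
  have "(\<Sum>\<^sub>\<infinity>a\<in>S. back_prob (shd x) a * tree_sum f (branch \<tau> a) (a ## x))
    \<le> transfer (\<lambda>y. max 0 (best_sum f n y)) x"
    unfolding transfer_def
  proof (rule infsum_mono)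
    show "(\<lambda>a. back_prob (shd x) a * tree_sum f (branch \<tau> a) (a ## x)) summable_on S"
      by (rule tree_sum_rec(2)[OF \<tau> x(1)])
    show "(\<lambda>a. back_prob (shd x) a * max 0 (best_sum f n (a ## x))) summable_on S"
      using x(3) by (simp add: transferable_def)
    fix a assume a: "a \<in> S"
    show "back_prob (shd x) a * tree_sum f (branch \<tau> a) (a ## x) \<le>
      back_prob (shd x) a * max 0 (best_sum f n (a ## x))"
    proof (cases "back_prob (shd x) a = 0 \<or> branch \<tau> a = {}")
      case True
      then show ?thesis
        using back_nonneg[OF a shd_in_S[OF x(1)]] by (auto simp: tree_sum_empty)
    next
      case False
      have "branch \<tau> a \<subseteq> words_le S n"
        using Suc.prems(2) by (fastforce simp: branch_def words_le_def)
      then have "tree_sum f (branch \<tau> a) (a ## x) \<le> best_sum f n (a ## x)"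
        using False branch_in_trees[OF Suc.prems(1)] backward_regular_SCons[OF Suc.prems(3) a]
        by (intro Suc.IH) auto
      then show ?thesis
        using back_nonneg[OF a shd_in_S[OF x(1)]] by (intro mult_left_mono) auto
    qed
  qed
  then show ?case
    by (simp add: tree_sum_rec(1)[OF \<tau> x(1)])
qed

text \<open>The stopping rule that realises the dynamic programming equation. The optimal tree varies with \<open>x\<close>, which
is why the maximal function has to range over trees chosen separately at each point.\<close>

primrec best_tree :: "('a stream \<Rightarrow> real) \<Rightarrow> nat \<Rightarrow> 'a stream \<Rightarrow> 'a list set" where
  "best_tree f 0 x = {[]}"
| "best_tree f (Suc n) x =
     insert [] {w @ [a] |a w. a \<in> S \<and> 0 < best_sum f n (a ## x) \<and> w \<in> best_tree f n (a ## x)}"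

lemma branch_best_tree:
  "branch (best_tree f (Suc n) x) a =
    (if a \<in> S \<and> 0 < best_sum f n (a ## x) then best_tree f n (a ## x) else {})"
  by (auto simp: branch_def)

lemma best_tree_subset: "best_tree f n x \<subseteq> words_le S n"
proof (induction n arbitrary: x)
  case (Suc n)
  then show ?case by (fastforce simp: words_le_def)
qed (simp add: words_le_0)

lemma Nil_in_best_tree: "[] \<in> best_tree f n x"
  by (cases n) auto

lemma best_tree_suffix: "t1 @ t2 \<in> best_tree f n x \<Longrightarrow> t2 \<in> best_tree f n x"
proof (induction n arbitrary: x t2)
  case (Suc n)
  then show ?case
    by (cases t2 rule: rev_cases) (auto simp flip: append_assoc)
qed simp

lemma best_tree_in_trees: "best_tree f n x \<in> trees S"
  unfolding trees_def using best_tree_subset Nil_in_best_tree best_tree_suffix by blast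

lemma tree_sum_best_tree:
  assumes "backward_regular f x"
  shows "tree_sum f (best_tree f n x) x = best_sum f n x"
  using assms
proof (induction n arbitrary: x)
  case 0
  then show ?case
    using tree_sum_words_le_0[OF backward_regularD(1)[OF 0]] by (simp add: words_le_0)
next
  case (Suc n)
  note x = backward_regularD[OF Suc.prems]
  have "best_tree f (Suc n) x \<subseteq> lists S"
    using best_tree_subset words_le_subset_lists by blast
  moreover have "tree_summable f (best_tree f (Suc n) x) x"
    by (rule tree_summable_subset[OF x(2) best_tree_subset])
  ultimately have "tree_sum f (best_tree f (Suc n) x) x =
    f x + (\<Sum>\<^sub>\<infinity>a\<in>S. back_prob (shd x) a * tree_sum f (branch (best_tree f (Suc n) x) a) (a ## x))"
    using x(1) by (intro tree_sum_rec Nil_in_best_tree)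
  also have "(\<Sum>\<^sub>\<infinity>a\<in>S. back_prob (shd x) a * tree_sum f (branch (best_tree f (Suc n) x) a) (a ## x)) =
    transfer (\<lambda>y. max 0 (best_sum f n y)) x"
    unfolding transfer_def
  proof (intro infsum_cong)
    fix a assume "a \<in> S"
    then show "back_prob (shd x) a * tree_sum f (branch (best_tree f (Suc n) x) a) (a ## x) =
      back_prob (shd x) a * max 0 (best_sum f n (a ## x))"
      using Suc.IH[OF backward_regular_SCons[OF Suc.prems]]
      by (cases "back_prob (shd x) a = 0") (auto simp: branch_best_tree tree_sum_empty simp del: best_tree.simps)
  qed
  finally show ?case by simp
qed

lemma ex_tree_sum_pos_iff:
  assumes "backward_regular f x"
  shows "(\<exists>\<tau>\<in>trees S. 0 < tree_sum f \<tau> x) \<longleftrightarrow> (\<exists>n. 0 < best_sum f n x)"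
proof
  assume "\<exists>\<tau>\<in>trees S. 0 < tree_sum f \<tau> x"
  then obtain \<tau> n where "\<tau> \<in> trees S" "0 < tree_sum f \<tau> x" "\<tau> \<subseteq> words_le S n"
    by (auto simp: trees_def)
  then show "\<exists>n. 0 < best_sum f n x"
    using tree_sum_le_best_sum[OF _ _ assms] by (meson less_le_trans)
next
  assume "\<exists>n. 0 < best_sum f n x"
  then show "\<exists>\<tau>\<in>trees S. 0 < tree_sum f \<tau> x"
    using tree_sum_best_tree[OF assms] best_tree_in_trees by metis
qed

lemma best_sum_measurable [measurable]:
  "integrable M f \<Longrightarrow> best_sum f n \<in> borel_measurable M"
  using integrable_best_sum by blast

lemma integrable_indicator_mult:
  "A \<in> sets M \<Longrightarrow> integrable M f \<Longrightarrow> integrable M (\<lambda>x. indicator A x * f x :: real)"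
  using integrable_real_mult_indicator[of A M f] by (simp add: mult.commute)

text \<open>Garsia's argument. With \<open>U n = max 0 (best_sum f n)\<close>, on the set in question
\<open>f = U (m + 1) - T (U m)\<close>, while off it \<open>U (m + 1) - T (U m) \<le> 0\<close>. As \<open>A\<close> is invariant, the integrals
of \<open>T (U m)\<close> and \<open>U m\<close> over \<open>A\<close> agree, and \<open>U\<close> increases with the height.\<close>

lemma maximal_inequality_bounded_height:
  assumes [measurable]: "A \<in> sets M" and inv: "AE x in M. x \<in> A \<longleftrightarrow> stl x \<in> A"
    and f: "integrable M f"
  shows "0 \<le> (LINT x|M. indicator A x * (indicator {x\<in>space M. 0 < best_sum f n x} x * f x))"
proof (cases n)
  case 0
  then show ?thesis by (intro Bochner_Integration.integral_nonneg) (auto simp: indicator_def)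
next
  case (Suc m)
  have [measurable]: "f \<in> borel_measurable M" "\<And>n. best_sum f n \<in> borel_measurable M"
    using f by (auto intro: best_sum_measurable)
  define U where "U = (\<lambda>n y. max 0 (best_sum f n y))"
  have U: "integrable M (U k)" for k
    using integrable_max_best_sum[OF f] by (simp add: U_def)
  note iA = integrable_indicator_mult[OF \<open>A \<in> sets M\<close>]
  have "(LINT x|M. indicator A x * transfer (U m) x) = (LINT x|M. indicator A (stl x) * U m x)"
    by (rule integral_indicator_transfer[OF _ U]) simp
  also have "\<dots> = (LINT x|M. indicator A x * U m x)"
  proof (rule integral_cong_AE)
    show "AE x in M. indicator A (stl x) * U m x = indicator A x * U m x"
      using inv by eventually_elim (simp add: indicator_def)
  qed (auto simp: U_def)
  also have "\<dots> \<le> (LINT x|M. indicator A x * U n x)"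
  proof (intro integral_mono_AE iA U)
    show "AE x in M. indicator A x * U m x \<le> indicator A x * U n x"
      using AE_backward_regular[OF f]
    proof eventually_elim
      case (elim x)
      show ?case
        using best_sum_mono[OF elim, of m n] Suc by (auto simp: U_def indicator_def)
    qed
  qed
  finally have "0 \<le> (LINT x|M. indicator A x * U n x) - (LINT x|M. indicator A x * transfer (U m) x)"
    by simp
  also have "\<dots> = (LINT x|M. indicator A x * U n x - indicator A x * transfer (U m) x)"
    by (intro Bochner_Integration.integral_diff[symmetric] iA U integrable_transfer)
  also have "\<dots> \<le> (LINT x|M. indicator A x * (indicator {x\<in>space M. 0 < best_sum f n x} x * f x))"
  proof (rule integral_mono_AE)
    show "AE x in M. indicator A x * U n x - indicator A x * transfer (U m) x \<le>
      indicator A x * (indicator {x\<in>space M. 0 < best_sum f n x} x * f x)"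
      using AE_space
    proof eventually_elim
      case (elim x)
      have "0 \<le> transfer (U m) x"
        by (rule transfer_nonneg[OF elim]) (simp add: U_def)
      then show ?case
        using elim by (auto simp: indicator_def Suc U_def)
    qed
    show "integrable M (\<lambda>x. indicator A x * (indicator {x\<in>space M. 0 < best_sum f n x} x * f x))"
      by (intro iA integrable_indicator_mult f) simp
  qed (auto intro!: iA U integrable_transfer Bochner_Integration.integrable_diff)
  finally show ?thesis .
qed

text \<open>The sets \<open>0 < best_sum f n\<close> increase with \<open>n\<close> at almost every point, so the bound for each height passes to
the limit with dominating function \<open>\<bar>f\<bar>\<close>.\<close>

lemma maximal_inequality:
  assumes [measurable]: "A \<in> sets M" and inv: "AE x in M. x \<in> A \<longleftrightarrow> stl x \<in> A"
    and f: "integrable M f"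
  shows "0 \<le> (LINT x|M. indicator A x * (indicator {x\<in>space M. \<exists>n. 0 < best_sum f n x} x * f x))"
proof -
  let ?g = "\<lambda>n x. indicator A x * (indicator {x\<in>space M. 0 < best_sum f n x} x * f x)"
  let ?h = "\<lambda>x. indicator A x * (indicator {x\<in>space M. \<exists>n. 0 < best_sum f n x} x * f x)"
  have [measurable]: "f \<in> borel_measurable M" "\<And>n. best_sum f n \<in> borel_measurable M"
    using f by (auto intro: best_sum_measurable)
  have "(\<lambda>n. LINT x|M. ?g n x) \<longlonglongrightarrow> (LINT x|M. ?h x)"
  proof (rule integral_dominated_convergence)
    show "integrable M (\<lambda>x. \<bar>f x\<bar>)" using f by simp
    show "AE x in M. (\<lambda>n. ?g n x) \<longlonglongrightarrow> ?h x"
      using AE_backward_regular[OF f]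
    proof eventually_elim
      case (elim x)
      have "eventually (\<lambda>n. ?g n x = ?h x) sequentially"
      proof (cases "\<exists>n. 0 < best_sum f n x")
        case True
        then obtain m where "0 < best_sum f m x" by blast
        then have "0 < best_sum f n x" if "n \<ge> m" for n
          using best_sum_mono[OF elim that] by simp
        then have "?g n x = ?h x" if "n \<ge> m" for n
          using that True by (simp add: indicator_def)
        then show ?thesis
          unfolding eventually_sequentially by blast
      next
        case False
        then have "?g n x = ?h x" for n by (auto simp: indicator_def)
        then show ?thesis by simp
      qed
      then show ?case by (rule tendsto_eventually)
    qed
  qed (auto simp: indicator_def)
  then show ?thesis
    using maximal_inequality_bounded_height[OF assms] by (intro LIMSEQ_le_const) auto
qed

section \<open>Invariant sets\<close>

lemma space_shift_invariant_algebra: "space (shift_invariant_algebra M) = space M"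
  by (simp add: shift_invariant_algebra_def space_measure_of_conv)

text \<open>The invariant measurable sets already form a sigma-algebra, so generating one from them adds no set.\<close>

lemma sets_shift_invariant_algebra:
  "A \<in> sets (shift_invariant_algebra M) \<longleftrightarrow> A \<in> sets M \<and> stl -` A \<inter> space M = A"
proof
  let ?I = "{A \<in> sets M. stl -` A \<inter> space M = A}"
  have I: "?I \<subseteq> Pow (space M)" using sets.sets_into_space by blast
  show "A \<in> sets M \<and> stl -` A \<inter> space M = A" if "A \<in> sets (shift_invariant_algebra M)"
  proof -
    have "A \<in> sigma_sets (space M) ?I"
      using that I by (simp add: shift_invariant_algebra_def)
    then show ?thesis
    proof induction
      case (Compl a)
      then show ?case using stl_in_space by auto
    next
      case (Union a)
      then show ?case by (auto simp: vimage_UN)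
    qed auto
  qed
  show "A \<in> sets M \<and> stl -` A \<inter> space M = A \<Longrightarrow> A \<in> sets (shift_invariant_algebra M)"
    using I by (simp add: shift_invariant_algebra_def sigma_sets.Basic)
qed

lemma subalgebra_shift_invariant: "subalgebra M (shift_invariant_algebra M)"
  by (auto simp: subalgebra_def space_shift_invariant_algebra sets_shift_invariant_algebra)

sublocale invariant: finite_measure_subalgebra M "shift_invariant_algebra M"
  by unfold_locales (rule subalgebra_shift_invariant)

lemma invariant_stl:
  assumes g: "g \<in> borel_measurable (shift_invariant_algebra M)" and x: "x \<in> space M"
  shows "g (stl x) = (g x :: real)"
proof -
  let ?A = "g -` {g x} \<inter> space M"
  have "?A \<in> sets (shift_invariant_algebra M)"
    using measurable_sets[OF g, of "{g x}"] by (simp add: space_shift_invariant_algebra)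
  then have "stl -` ?A \<inter> space M = ?A" by (simp add: sets_shift_invariant_algebra)
  then show ?thesis using x by blast
qed

lemma invariant_shift:
  assumes g: "g \<in> borel_measurable (shift_invariant_algebra M)" and x: "x \<in> space M" and w: "w \<in> lists S"
  shows "g (w @- x) = (g x :: real)"
  using w
proof (induction w)
  case (Cons a w)
  then show ?case
    using invariant_stl[OF g, of "a ## (w @- x)"] shift_in_space[of "a # w" x] x by auto
qed simp

text \<open>A set and its preimage under the shift have the same finite measure, so an inclusion between them is an
equality up to a null set.\<close>

lemma AE_invariant_of_subinvariant:
  assumes [measurable]: "A \<in> sets M" and sub: "AE x in M. x \<in> A \<longrightarrow> stl x \<in> A"
  shows "AE x in M. x \<in> A \<longleftrightarrow> stl x \<in> A"
proof -
  define C where "C = stl -` A \<inter> space M"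
  have [measurable]: "C \<in> sets M" unfolding C_def by measurable
  have "measure M C = measure (distr M M stl) A"
    unfolding C_def by (rule measure_distr[symmetric]) auto
  then have "measure M C = measure M A"
    by (simp add: distr_stl)
  also have "\<dots> = measure M (C \<inter> A)"
    using sub AE_space by (intro finite_measure_eq_AE) (auto simp: C_def)
  finally have "measure M (C - A) = 0"
    using finite_measure_Diff'[of C A] by simp
  then have "AE x in M. x \<notin> C - A"
    by (subst prob_eq_0[symmetric]) auto
  with sub AE_space show ?thesis
    by eventually_elim (auto simp: C_def)
qed

text \<open>The paths all of whose late shifts lie in \<open>A\<close> form a strictly invariant set, because the shift does not
change the tail of the orbit.\<close>

lemma AE_eq_strictly_invariant:
  assumes [measurable]: "A \<in> sets M" and inv: "AE x in M. x \<in> A \<longleftrightarrow> stl x \<in> A"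
  obtains B where "B \<in> sets (shift_invariant_algebra M)" "AE x in M. x \<in> A \<longleftrightarrow> x \<in> B"
proof
  \<comment> \<open>"for all large \<open>n\<close>" is insensitive to replacing \<open>x\<close> by \<open>stl x\<close>, unlike "for all \<open>n\<close>"\<close>
  define B where "B = {x\<in>space M. \<exists>N. \<forall>n. N \<le> n \<longrightarrow> sdrop n x \<in> A}"
  have [measurable]: "sdrop n \<in> M \<rightarrow>\<^sub>M M" for n by measurable
  have "B \<in> sets M" unfolding B_def by measurable
  moreover have "stl x \<in> B \<longleftrightarrow> x \<in> B" if "x \<in> space M" for x
  proof -
    have "(\<exists>N. \<forall>n. N \<le> n \<longrightarrow> sdrop n (stl x) \<in> A) \<longleftrightarrow> (\<exists>N. \<forall>n. N \<le> n \<longrightarrow> sdrop n x \<in> A)"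
      using eventually_sequentially_Suc[of "\<lambda>n. sdrop n x \<in> A"]
      by (simp add: eventually_sequentially)
    then show ?thesis using that stl_in_space by (simp add: B_def)
  qed
  ultimately show "B \<in> sets (shift_invariant_algebra M)"
    unfolding sets_shift_invariant_algebra using sets.sets_into_space by blast
  have "AE x in M. x \<in> A \<longleftrightarrow> sdrop n x \<in> A" for n
  proof (induction n)
    case (Suc n)
    from inv AE_stl[OF Suc] show ?case by eventually_elim simp
  qed simp
  then have "AE x in M. \<forall>n. x \<in> A \<longleftrightarrow> sdrop n x \<in> A"
    by (simp add: AE_all_countable)
  then show "AE x in M. x \<in> A \<longleftrightarrow> x \<in> B"
    using AE_space by eventually_elim (auto simp: B_def)
qed

section \<open>Almost sure bounds on tree sums\<close>

text \<open>The heart of the pointwise theorem. The set \<open>A\<close> of points where the best sums of \<open>g\<close> are unbounded is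
invariant up to a null set, because a large best sum at \<open>a ## x\<close> forces a large one at \<open>x\<close>. It is
contained in the set on which some best sum is positive, so by the maximal inequality the integral of
\<open>g\<close> over \<open>A\<close> is nonnegative; but \<open>g\<close> has conditional expectation \<open>- \<epsilon>\<close>.\<close>

lemma AE_best_sum_bounded:
  assumes f: "integrable M f" and \<epsilon>: "0 < \<epsilon>"
  defines "g \<equiv> \<lambda>x. f x - real_cond_exp M (shift_invariant_algebra M) f x - \<epsilon>"
  shows "AE x in M. \<exists>C. \<forall>n. best_sum g n x \<le> C"
proof -
  let ?fbar = "real_cond_exp M (shift_invariant_algebra M) f"
  have fbar: "integrable M ?fbar"
    using f by (rule invariant.real_cond_exp_int)
  have g: "integrable M g"
    unfolding g_def using f fbar by simp
  have [measurable]: "g \<in> borel_measurable M" "\<And>n. best_sum g n \<in> borel_measurable M"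
    using g by (auto intro: best_sum_measurable)
  define A where "A = {x\<in>space M. \<forall>k::nat. \<exists>n. real k < best_sum g n x}"
  have [measurable]: "A \<in> sets M" unfolding A_def by measurable
  have "AE x in M. \<forall>a\<in>S. back_prob (shd x) a \<noteq> 0 \<longrightarrow> (a ## x \<in> A \<longrightarrow> stl (a ## x) \<in> A)"
    using AE_backward_regular[OF g]
  proof eventually_elim
    case (elim x)
    note x = backward_regularD[OF elim]
    show ?case
    proof (intro ballI impI)
      fix a assume a: "a \<in> S" "back_prob (shd x) a \<noteq> 0" "a ## x \<in> A"
      then have pos: "0 < back_prob (shd x) a"
        using back_nonneg[OF a(1) shd_in_S[OF x(1)]] by simp
      have "\<exists>n. real k < best_sum g n x" for k
      proof -
        \<comment> \<open>a best sum exceeding \<open>k'\<close> at \<open>a ## x\<close> exceeds \<open>k\<close> at \<open>x\<close> after the loss by \<open>g x\<close>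
            and the factor \<open>back_prob (shd x) a\<close>\<close>
        obtain k' :: nat where k': "(real k - g x) / back_prob (shd x) a < real k'"
          using reals_Archimedean2 by blast
        obtain n where n: "real k' < best_sum g n (a ## x)"
          using a(3) by (auto simp: A_def)
        have "real k - g x < back_prob (shd x) a * real k'"
          using k' pos by (simp add: pos_divide_less_eq mult.commute)
        also have "\<dots> < back_prob (shd x) a * best_sum g n (a ## x)"
          using n pos by (rule mult_strict_left_mono)
        also have "\<dots> \<le> back_prob (shd x) a * max 0 (best_sum g n (a ## x))"
          using pos by simp
        also have "\<dots> \<le> transfer (\<lambda>y. max 0 (best_sum g n y)) x"
          using transfer_ge_term[OF x(1) a(1) x(3)] by simp
        finally have "real k < best_sum g (Suc n) x" by simp
        then show ?thesis by blast
      qed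
      then show "stl (a ## x) \<in> A" using x(1) by (simp add: A_def)
    qed
  qed
  then have "AE x in M. x \<in> A \<longrightarrow> stl x \<in> A"
    by (rule AE_backwardD[rotated]) measurable
  then have inv: "AE x in M. x \<in> A \<longleftrightarrow> stl x \<in> A"
    by (rule AE_invariant_of_subinvariant[rotated]) simp
  then obtain B where B: "B \<in> sets (shift_invariant_algebra M)" "AE x in M. x \<in> A \<longleftrightarrow> x \<in> B"
    using AE_eq_strictly_invariant[OF \<open>A \<in> sets M\<close>] by blast
  have [measurable]: "B \<in> sets M" using B(1) by (simp add: sets_shift_invariant_algebra)
  have "0 \<le> (LINT x|M. indicator A x * (indicator {x\<in>space M. \<exists>n. 0 < best_sum g n x} x * g x))"
    by (rule maximal_inequality[OF _ inv g]) simp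
  also have "\<dots> = (LINT x|M. indicator B x * g x)"
  proof (rule integral_cong_AE)
    show "AE x in M. indicator A x * (indicator {x\<in>space M. \<exists>n. 0 < best_sum g n x} x * g x) = indicator B x * g x"
      using B(2)
    proof eventually_elim
      case (elim x)
      have "x \<in> A \<Longrightarrow> x \<in> {x\<in>space M. \<exists>n. 0 < best_sum g n x}"
        unfolding A_def by simp (metis of_nat_0)
      then show ?case using elim by (auto simp: indicator_def)
    qed
  qed auto
  also have "\<dots> = (LINT x|M. (indicator B x * f x - indicator B x * ?fbar x) - \<epsilon> * indicator B x)"
    by (rule Bochner_Integration.integral_cong) (auto simp: g_def indicator_def)
  also have "\<dots> = (LINT x|M. indicator B x * f x) - (LINT x|M. indicator B x * ?fbar x) - \<epsilon> * measure M B"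
  proof -
    have "integrable M (\<lambda>x. indicator B x * f x)" "integrable M (\<lambda>x. indicator B x * ?fbar x)"
      by (intro integrable_indicator_mult f fbar; simp)+
    then show ?thesis by (simp add: less_top[symmetric])
  qed
  also have "(LINT x|M. indicator B x * f x) = (LINT x|M. indicator B x * ?fbar x)"
    using invariant.real_cond_exp_intA[OF f B(1)] by (simp add: set_lebesgue_integral_def)
  finally have "measure M B = 0"
    using \<epsilon> measure_nonneg[of M B] by (simp add: mult_le_0_iff)
  then have "AE x in M. x \<notin> B"
    by (subst prob_eq_0[symmetric]) auto
  with B(2) AE_space show ?thesis
  proof eventually_elim
    case (elim x)
    then obtain k :: nat where "\<forall>n. best_sum g n x \<le> real k"
      by (auto simp: A_def not_less)
    then show ?case by blast
  qed
qed

lemma tree_subset_words_le: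
  assumes "\<tau> \<in> trees S" obtains n where "\<tau> \<subseteq> words_le S n"
  using assms by (auto simp: trees_def)

lemma trees_subset_lists: "\<tau> \<in> trees S \<Longrightarrow> \<tau> \<subseteq> lists S"
  using words_le_subset_lists by (auto simp: trees_def)

lemma AE_tree_summable_trees:
  assumes f: "integrable M f"
  shows "AE x in M. \<forall>\<tau>\<in>trees S. tree_summable f \<tau> x"
  using AE_tree_summable[OF f]
  by eventually_elim (meson tree_subset_words_le tree_summable_subset)

lemma tree_sum_diff_invariant:
  assumes "tree_summable f \<tau> x" "tree_summable (\<lambda>_. 1) \<tau> x"
    and "\<And>w. w \<in> \<tau> \<Longrightarrow> c (w @- x) = c x"
  shows "tree_sum (\<lambda>y. f y - c y) \<tau> x = tree_sum f \<tau> x - c x * tree_sum (\<lambda>_. 1) \<tau> x"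
proof -
  have "tree_sum (\<lambda>y. f y - c y) \<tau> x =
    (\<Sum>\<^sub>\<infinity>w\<in>\<tau>. back_word w (shd x) * f (w @- x) + (- c x) * (back_word w (shd x) * 1))"
    unfolding tree_sum_def by (intro infsum_cong) (simp add: assms(3) algebra_simps)
  also have "\<dots> = tree_sum f \<tau> x + (\<Sum>\<^sub>\<infinity>w\<in>\<tau>. (- c x) * (back_word w (shd x) * 1))"
    unfolding tree_sum_def using assms(1,2)
    by (intro infsum_add summable_on_cmult_right) (simp_all add: tree_summable_def)
  also have "(\<Sum>\<^sub>\<infinity>w\<in>\<tau>. (- c x) * (back_word w (shd x) * 1)) = (- c x) * tree_sum (\<lambda>_. 1) \<tau> x"
    unfolding tree_sum_def by (rule infsum_cmult_right')
  finally show ?thesis by simp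
qed

text \<open>As \<open>fbar\<close> does not change under prefixing of words, the tree sum of \<open>f - fbar - \<epsilon>\<close> splits off the mass of
the tree. The constant works for all trees at once, whatever their height.\<close>

lemma AE_tree_sum_upper_bound:
  assumes f: "integrable M f" and \<epsilon>: "0 < \<epsilon>"
  shows "AE x in M. \<exists>C. \<forall>\<tau>\<in>trees S. tree_sum f \<tau> x \<le>
    (real_cond_exp M (shift_invariant_algebra M) f x + \<epsilon>) * tree_sum (\<lambda>_. 1) \<tau> x + C"
proof -
  let ?fbar = "real_cond_exp M (shift_invariant_algebra M) f"
  define g where "g = (\<lambda>x. f x - ?fbar x - \<epsilon>)"
  have "integrable M ?fbar"
    using f by (rule invariant.real_cond_exp_int)
  then have g: "integrable M g"
    unfolding g_def using f by simp
  have one: "integrable M (\<lambda>_. 1 :: real)" by simp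
  show ?thesis
    using AE_best_sum_bounded[OF f \<epsilon>, folded g_def] AE_backward_regular[OF g]
      AE_tree_summable_trees[OF f] AE_tree_summable_trees[OF one] AE_space
  proof eventually_elim
    case (elim x)
    then obtain C where C: "best_sum g n x \<le> C" for n by blast
    have "tree_sum f \<tau> x \<le> (?fbar x + \<epsilon>) * tree_sum (\<lambda>_. 1) \<tau> x + C" if \<tau>: "\<tau> \<in> trees S" for \<tau>
    proof -
      obtain n where n: "\<tau> \<subseteq> words_le S n" using \<tau> by (rule tree_subset_words_le)
      have "tree_sum (\<lambda>y. f y - (?fbar y + \<epsilon>)) \<tau> x = tree_sum f \<tau> x - (?fbar x + \<epsilon>) * tree_sum (\<lambda>_. 1) \<tau> x"
      proof (rule tree_sum_diff_invariant)
        show "?fbar (w @- x) + \<epsilon> = ?fbar x + \<epsilon>" if "w \<in> \<tau>" for w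
          using that trees_subset_lists[OF \<tau>] elim(5) by (subst invariant_shift) auto
      qed (use elim \<tau> in auto)
      moreover have "(\<lambda>y. f y - (?fbar y + \<epsilon>)) = g" by (auto simp: g_def)
      moreover have "tree_sum g \<tau> x \<le> C"
        using tree_sum_le_best_sum[OF \<tau> n elim(2)] C[of n] by simp
      ultimately show ?thesis by simp
    qed
    then show ?case by blast
  qed
qed

section \<open>Pointwise convergence of tree averages\<close>

lemma markov_word_snoc_eq: "b \<in> S \<Longrightarrow> markov_word P \<pi> (w @ [b]) = \<pi> b * back_word w b"
  using init_pos[of b] by (simp add: back_word_def)

lemma tree_summable_iff:
  assumes "x \<in> space M"
  shows "(\<lambda>w. f (w @- x) * markov_word P \<pi> (w @ [shd x])) summable_on \<tau> \<longleftrightarrow> tree_summable f \<tau> x"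
proof -
  note b = shd_in_S[OF assms]
  have "(\<lambda>w. f (w @- x) * markov_word P \<pi> (w @ [shd x])) = (\<lambda>w. \<pi> (shd x) * (back_word w (shd x) * f (w @- x)))"
    by (simp add: markov_word_snoc_eq[OF b] mult_ac)
  then show ?thesis
    using init_pos[OF b] by (simp add: tree_summable_def summable_on_cmult_right')
qed

lemma weighted_sum_eq:
  assumes "x \<in> space M"
  shows "weighted_sum P \<pi> f \<tau> x = \<pi> (shd x) * tree_sum f \<tau> x"
  unfolding weighted_sum_def tree_sum_def infsum_cmult_right'[symmetric]
  by (intro infsum_cong) (simp add: markov_word_snoc_eq[OF shd_in_S[OF assms]] mult_ac)

lemma markov_set_app_letter:
  assumes "x \<in> space M"
  shows "markov_set P \<pi> (app_letter \<tau> (shd x)) = \<pi> (shd x) * tree_sum (\<lambda>_. 1) \<tau> x"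
proof -
  have "inj_on (\<lambda>w. w @ [shd x]) \<tau>" by (auto simp: inj_on_def)
  then have "markov_set P \<pi> (app_letter \<tau> (shd x)) = (\<Sum>\<^sub>\<infinity>w\<in>\<tau>. markov_word P \<pi> (w @ [shd x]))"
    by (simp add: markov_set_def app_letter_def infsum_reindex o_def)
  also have "\<dots> = (\<Sum>\<^sub>\<infinity>w\<in>\<tau>. \<pi> (shd x) * (back_word w (shd x) * 1))"
    by (intro infsum_cong) (simp add: markov_word_snoc_eq[OF shd_in_S[OF assms]])
  finally show ?thesis
    by (simp add: tree_sum_def infsum_cmult_right')
qed

lemma tree_average_eq:
  assumes "x \<in> space M"
  shows "tree_average P \<pi> f \<tau> x = tree_sum f \<tau> x / tree_sum (\<lambda>_. 1) \<tau> x"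
  using init_pos[OF shd_in_S[OF assms]]
  by (simp add: tree_average_def weighted_sum_eq[OF assms] markov_set_app_letter[OF assms])

text \<open>Each level has mass \<open>1\<close> because the reversed chain is stochastic. This holds at every point and not only
almost surely.\<close>

lemma tree_sum_one_words_le:
  assumes "x \<in> space M"
  shows "tree_summable (\<lambda>_. 1) (words_le S n) x \<and> tree_sum (\<lambda>_. 1) (words_le S n) x = real (n + 1)"
  using assms
proof (induction n arbitrary: x)
  case 0
  then show ?case by (simp add: tree_summable_words_le_0 tree_sum_words_le_0)
next
  case (Suc n)
  have IH: "tree_summable (\<lambda>_. 1) (words_le S n) (a ## x)"
    "tree_sum (\<lambda>_. 1) (words_le S n) (a ## x) = real (n + 1)" if "a \<in> S" for a
    using Suc.IH SCons_in_space[OF Suc.prems that] by auto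
  have sum: "((\<lambda>a. back_prob (shd x) a * real (n + 1)) has_sum real (n + 1)) S"
    using has_sum_cmult_left[OF back_has_sum_shd[OF Suc.prems], of "real (n + 1)"] by simp
  then have "(\<lambda>a. back_prob (shd x) a * real (n + 1)) summable_on S"
    by (rule has_sum_imp_summable)
  then have "transferable (tree_sum (\<lambda>_. 1) (words_le S n)) x"
    unfolding transferable_def
    by (rule summable_on_cong[THEN iffD1, rotated]) (simp add: IH)
  then have s: "tree_summable (\<lambda>_. 1) (words_le S (Suc n)) x"
    using Suc.prems by (intro tree_summable_words_le_Suc IH) auto
  have "transfer (tree_sum (\<lambda>_. 1) (words_le S n)) x = (\<Sum>\<^sub>\<infinity>a\<in>S. back_prob (shd x) a * real (n + 1))"
    unfolding transfer_def by (intro infsum_cong) (simp add: IH)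
  also have "\<dots> = real (n + 1)"
    using sum by (rule infsumI)
  finally show ?case
    using s tree_sum_words_le_Suc[OF s Suc.prems] by simp
qed

lemma tree_summable_one:
  assumes "\<tau> \<in> trees S" "x \<in> space M" shows "tree_summable (\<lambda>_. 1) \<tau> x"
  using tree_subset_words_le[OF assms(1)] tree_sum_one_words_le[OF assms(2)] tree_summable_subset by metis

lemma tree_sum_one_ge_1:
  assumes "\<tau> \<in> trees S" "x \<in> space M" shows "1 \<le> tree_sum (\<lambda>_. 1) \<tau> x"
proof -
  have "sum (\<lambda>w. back_word w (shd x) * 1) {[]} \<le> tree_sum (\<lambda>_. 1) \<tau> x"
    unfolding tree_sum_def using tree_summable_one[OF assms] assms trees_subset_lists[OF assms(1)]
    by (intro finite_sum_le_infsum)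
       (auto simp: tree_summable_def trees_def shd_in_S intro!: back_word_nonneg)
  then show ?thesis
    using assms by (simp add: back_word_Nil shd_in_S)
qed

lemma tree_sum_uminus: "tree_sum (\<lambda>y. - f y) \<tau> x = - tree_sum f \<tau> x"
  unfolding tree_sum_def by (simp add: infsum_uminus)

lemma AE_tree_sum_near_conditional_expectation:
  assumes f: "integrable M f" and \<epsilon>: "0 < \<epsilon>"
  defines "fbar \<equiv> real_cond_exp M (shift_invariant_algebra M) f"
  shows "AE x in M. \<exists>C>0. \<forall>\<tau>\<in>trees S.
    \<bar>tree_sum f \<tau> x - fbar x * tree_sum (\<lambda>_. 1) \<tau> x\<bar> \<le> \<epsilon> * tree_sum (\<lambda>_. 1) \<tau> x + C"
proof -
  let ?mbar = "real_cond_exp M (shift_invariant_algebra M) (\<lambda>x. - f x)"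
  have minus: "AE x in M. ?mbar x = - fbar x"
    using invariant.real_cond_exp_cmult[OF f, of "-1"] by (simp add: fbar_def)
  have mf: "integrable M (\<lambda>x. - f x)" using f by simp
  show ?thesis
    using minus AE_tree_sum_upper_bound[OF f \<epsilon>, folded fbar_def] AE_tree_sum_upper_bound[OF mf \<epsilon>]
  proof eventually_elim
    case (elim x)
    let ?W = "\<lambda>\<tau>. tree_sum (\<lambda>_. 1) \<tau> x"
    obtain C where C: "\<And>\<tau>. \<tau> \<in> trees S \<Longrightarrow> tree_sum f \<tau> x \<le> (fbar x + \<epsilon>) * ?W \<tau> + C"
      using elim(2) by blast
    obtain D where D: "\<And>\<tau>. \<tau> \<in> trees S \<Longrightarrow> - tree_sum f \<tau> x \<le> (- fbar x + \<epsilon>) * ?W \<tau> + D"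
      using elim(3) by (auto simp: elim(1) tree_sum_uminus)
    have "\<bar>tree_sum f \<tau> x - fbar x * ?W \<tau>\<bar> \<le> \<epsilon> * ?W \<tau> + max 1 (max C D)" if "\<tau> \<in> trees S" for \<tau>
      using C[OF that] D[OF that] by (auto simp: abs_le_iff algebra_simps)
    then show ?case by (intro exI[of _ "max 1 (max C D)"]) auto
  qed
qed

text \<open>After division by the mass of the tree, the constant in the previous bound becomes negligible. The null set
there depends on \<open>\<epsilon>\<close>, so the bound is used for a sequence of values tending to \<open>0\<close>.\<close>

lemma AE_tree_average_converges:
  assumes f: "integrable M f"
  defines "fbar \<equiv> real_cond_exp M (shift_invariant_algebra M) f"
  shows "AE x in M. \<forall>\<epsilon>>0. \<exists>K>0. \<forall>\<tau>\<in>trees S. markov_set P \<pi> (app_letter \<tau> (shd x)) \<ge> K \<longrightarrow>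
        \<bar>tree_average P \<pi> f \<tau> x - fbar x\<bar> < \<epsilon>"
proof -
  have "AE x in M. \<forall>k::nat. \<exists>C>0. \<forall>\<tau>\<in>trees S.
    \<bar>tree_sum f \<tau> x - fbar x * tree_sum (\<lambda>_. 1) \<tau> x\<bar> \<le> inverse (real (Suc k)) * tree_sum (\<lambda>_. 1) \<tau> x + C"
    unfolding AE_all_countable fbar_def
    by (intro allI AE_tree_sum_near_conditional_expectation f) simp
  then show ?thesis
    using AE_space
  proof eventually_elim
    case (elim x)
    let ?W = "\<lambda>\<tau>. tree_sum (\<lambda>_. 1) \<tau> x"
    note pos = init_pos[OF shd_in_S[OF elim(2)]]
    show ?case
    proof (intro allI impI)
      fix \<epsilon> :: real assume \<epsilon>: "0 < \<epsilon>"
      then obtain k where k: "inverse (real (Suc k)) < \<epsilon> / 2"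
        using reals_Archimedean[of "\<epsilon> / 2"] by auto
      obtain C where C: "0 < C" "\<And>\<tau>. \<tau> \<in> trees S \<Longrightarrow>
        \<bar>tree_sum f \<tau> x - fbar x * ?W \<tau>\<bar> \<le> inverse (real (Suc k)) * ?W \<tau> + C"
        using elim(1) by blast
      have "\<bar>tree_average P \<pi> f \<tau> x - fbar x\<bar> < \<epsilon>"
        if \<tau>: "\<tau> \<in> trees S" and K: "\<pi> (shd x) * (2 * C / \<epsilon>) \<le> markov_set P \<pi> (app_letter \<tau> (shd x))" for \<tau>
      proof -
        have W: "0 < ?W \<tau>" using tree_sum_one_ge_1[OF \<tau> elim(2)] by simp
        have "2 * C / \<epsilon> \<le> ?W \<tau>"
          using K unfolding markov_set_app_letter[OF elim(2)] mult_le_cancel_left_pos[OF pos] .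
        then have "C \<le> \<epsilon> / 2 * ?W \<tau>"
          using \<epsilon> by (simp add: field_simps)
        moreover have "inverse (real (Suc k)) * ?W \<tau> < \<epsilon> / 2 * ?W \<tau>"
          using k W by (rule mult_strict_right_mono)
        moreover have "\<epsilon> / 2 * ?W \<tau> + \<epsilon> / 2 * ?W \<tau> = \<epsilon> * ?W \<tau>"
          by simp
        ultimately have "\<bar>tree_sum f \<tau> x - fbar x * ?W \<tau>\<bar> < \<epsilon> * ?W \<tau>"
          using C(2)[OF \<tau>] by linarith
        then have "\<bar>tree_sum f \<tau> x - fbar x * ?W \<tau>\<bar> / ?W \<tau> < \<epsilon>"
          using W by (simp add: pos_divide_less_eq)
        also have "\<bar>tree_sum f \<tau> x - fbar x * ?W \<tau>\<bar> / ?W \<tau> = \<bar>(tree_sum f \<tau> x - fbar x * ?W \<tau>) / ?W \<tau>\<bar>"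
          using W by (simp add: abs_divide)
        also have "(tree_sum f \<tau> x - fbar x * ?W \<tau>) / ?W \<tau> = tree_average P \<pi> f \<tau> x - fbar x"
          using W by (simp add: tree_average_eq[OF elim(2)] field_simps)
        finally show ?thesis .
      qed
      moreover have "0 < \<pi> (shd x) * (2 * C / \<epsilon>)" using pos C(1) \<epsilon> by simp
      ultimately show "\<exists>K>0. \<forall>\<tau>\<in>trees S. markov_set P \<pi> (app_letter \<tau> (shd x)) \<ge> K \<longrightarrow>
        \<bar>tree_average P \<pi> f \<tau> x - fbar x\<bar> < \<epsilon>" by blast
    qed
  qed
qed

section \<open>Averages over all words of bounded length\<close>

definition level_average :: "('a stream \<Rightarrow> real) \<Rightarrow> nat \<Rightarrow> 'a stream \<Rightarrow> real" where
  "level_average f n x = 1 / (real (n + 1) * markov_word P \<pi> [shd x]) * weighted_sum P \<pi> f (words_le S n) x"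

lemma level_average_eq:
  assumes "x \<in> space M"
  shows "level_average f n x = tree_sum f (words_le S n) x / real (n + 1)"
  using init_pos[OF shd_in_S[OF assms]]
  by (simp add: level_average_def weighted_sum_eq[OF assms] markov_word_def)

lemma level_average_eq_tree_average:
  assumes "x \<in> space M"
  shows "level_average f n x = tree_average P \<pi> f (words_le S n) x"
  using tree_sum_one_words_le[OF assms, of n] by (simp add: level_average_eq assms tree_average_eq)

lemma integral_level_average:
  assumes "integrable M f"
  shows "integrable M (level_average f n)" "(LINT x|M. level_average f n x) = (LINT x|M. f x)"
proof -
  have "integrable M (\<lambda>x. tree_sum f (words_le S n) x / real (n + 1))"
    using integral_tree_sum_words_le(1)[OF assms] by simp
  then show "integrable M (level_average f n)"
    by (rule Bochner_Integration.integrable_cong[THEN iffD1, OF refl, rotated]) (simp add: level_average_eq)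
  have "(LINT x|M. level_average f n x) = (LINT x|M. tree_sum f (words_le S n) x / real (n + 1))"
    by (intro Bochner_Integration.integral_cong) (simp_all add: level_average_eq)
  also have "\<dots> = (LINT x|M. f x)"
    using integral_tree_sum_words_le(2)[OF assms, of n] by simp
  finally show "(LINT x|M. level_average f n x) = (LINT x|M. f x)" .
qed

lemma AE_level_average_tendsto:
  assumes f: "integrable M f"
  shows "AE x in M. (\<lambda>n. level_average f n x) \<longlonglongrightarrow> real_cond_exp M (shift_invariant_algebra M) f x"
  using AE_tree_average_converges[OF f] AE_space
proof eventually_elim
  case (elim x)
  let ?fbar = "real_cond_exp M (shift_invariant_algebra M) f"
  note pos = init_pos[OF shd_in_S[OF elim(2)]]
  show ?case
  proof (rule LIMSEQ_I)
    fix \<epsilon> :: real assume "0 < \<epsilon>"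
    then obtain K where K: "\<And>\<tau>. \<tau> \<in> trees S \<Longrightarrow> markov_set P \<pi> (app_letter \<tau> (shd x)) \<ge> K \<Longrightarrow>
        \<bar>tree_average P \<pi> f \<tau> x - ?fbar x\<bar> < \<epsilon>"
      using elim(1) by blast
    obtain N :: nat where N: "K / \<pi> (shd x) < real N"
      using reals_Archimedean2 by blast
    have "norm (level_average f n x - ?fbar x) < \<epsilon>" if "n \<ge> N" for n
    proof -
      have "K / \<pi> (shd x) \<le> real (n + 1)" using N that by simp
      then have "K \<le> markov_set P \<pi> (app_letter (words_le S n) (shd x))"
        using pos tree_sum_one_words_le[OF elim(2), of n]
        by (simp add: markov_set_app_letter[OF elim(2)] pos_divide_le_eq mult.commute)
      from K[OF words_le_in_trees this] show ?thesis
        by (simp add: level_average_eq_tree_average[OF elim(2)])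
    qed
    then show "\<exists>N. \<forall>n\<ge>N. norm (level_average f n x - ?fbar x) < \<epsilon>" by blast
  qed
qed

text \<open>Jensen's inequality: sum the supporting line of \<open>t powr p\<close> at the average \<open>s\<close> of \<open>\<bar>f\<bar>\<close> against the
weights, whose total mass is \<open>n + 1\<close>; the linear term vanishes.\<close>

lemma level_average_powr_le:
  assumes p: "1 \<le> p" and x: "x \<in> space M"
    and f: "tree_summable f (words_le S n) x"
    and fp: "tree_summable (\<lambda>y. \<bar>f y\<bar> powr p) (words_le S n) x"
  shows "\<bar>level_average f n x\<bar> powr p \<le> level_average (\<lambda>y. \<bar>f y\<bar> powr p) n x"
proof -
  let ?W = "words_le S n" and ?b = "\<lambda>w. back_word w (shd x)"
  have b: "0 \<le> ?b w" if "w \<in> ?W" for w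
    using that shd_in_S[OF x] by (intro back_word_nonneg) (auto simp: words_le_def)
  have one: "tree_summable (\<lambda>_. 1) ?W x" "tree_sum (\<lambda>_. 1) ?W x = real (n + 1)"
    using tree_sum_one_words_le[OF x, of n] by auto
  have abs_norm: "norm (?b w * f (w @- x)) = ?b w * \<bar>f (w @- x)\<bar>" if "w \<in> ?W" for w
    using b[OF that] by (simp add: abs_mult)
  have fn: "(\<lambda>w. norm (?b w * f (w @- x))) summable_on ?W"
    using f unfolding tree_summable_def by (rule iffD1[OF summable_on_iff_abs_summable_on_real])
  then have fa: "tree_summable (\<lambda>y. \<bar>f y\<bar>) ?W x"
    unfolding tree_summable_def by (rule summable_on_cong[THEN iffD1, rotated]) (rule abs_norm)
  define s where "s = tree_sum (\<lambda>y. \<bar>f y\<bar>) ?W x / real (n + 1)"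
  have "\<bar>tree_sum f ?W x\<bar> \<le> tree_sum (\<lambda>y. \<bar>f y\<bar>) ?W x"
    unfolding tree_sum_def using norm_infsum_bound[OF fn] abs_norm by (simp cong: infsum_cong)
  then have le_s: "\<bar>level_average f n x\<bar> \<le> s"
    unfolding level_average_eq[OF x] s_def abs_divide by (simp add: divide_right_mono)
  then have "0 \<le> s" by linarith
  then obtain c where c: "\<And>t. 0 \<le> t \<Longrightarrow> s powr p + c * (t - s) \<le> t powr p"
    using powr_supporting_line p by blast
  have "(\<Sum>\<^sub>\<infinity>w\<in>?W. (s powr p - c * s) * (?b w * 1) + c * (?b w * \<bar>f (w @- x)\<bar>))
    \<le> tree_sum (\<lambda>y. \<bar>f y\<bar> powr p) ?W x"
    unfolding tree_sum_def
  proof (rule infsum_mono)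
    fix w assume "w \<in> ?W"
    then have "?b w * (s powr p + c * (\<bar>f (w @- x)\<bar> - s)) \<le> ?b w * \<bar>f (w @- x)\<bar> powr p"
      using b c by (intro mult_left_mono) auto
    then show "(s powr p - c * s) * (?b w * 1) + c * (?b w * \<bar>f (w @- x)\<bar>) \<le> ?b w * \<bar>f (w @- x)\<bar> powr p"
      by (simp add: algebra_simps)
  qed (use one(1) fa fp in \<open>auto simp: tree_summable_def intro!: summable_on_add summable_on_cmult_right\<close>)
  also have "(\<Sum>\<^sub>\<infinity>w\<in>?W. (s powr p - c * s) * (?b w * 1) + c * (?b w * \<bar>f (w @- x)\<bar>)) =
    (s powr p - c * s) * tree_sum (\<lambda>_. 1) ?W x + c * tree_sum (\<lambda>y. \<bar>f y\<bar>) ?W x"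
    unfolding tree_sum_def infsum_cmult_right'[symmetric] using one(1) fa
    by (intro infsum_add summable_on_cmult_right) (auto simp: tree_summable_def)
  also have "\<dots> = real (n + 1) * s powr p"
    by (simp add: one(2) s_def field_simps)
  finally have "s powr p \<le> level_average (\<lambda>y. \<bar>f y\<bar> powr p) n x"
    by (simp add: level_average_eq[OF x] pos_le_divide_eq mult.commute)
  moreover have "\<bar>level_average f n x\<bar> powr p \<le> s powr p"
    using le_s p by (intro powr_mono2) auto
  ultimately show ?thesis by simp
qed

text \<open>The averages of \<open>h = \<bar>f\<bar> powr p\<close> are nonnegative, converge almost everywhere and all have the integral of
their limit, so Scheffe's lemma makes them converge in \<open>L\<^sup>1\<close>. By Jensen's inequality they control the
\<open>p\<close>-th powers of the averages of \<open>f\<close>, and in the limit that of \<open>fbar\<close>.\<close>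

lemma level_average_tendsto_Lp:
  assumes p: "1 \<le> p" and Lp: "in_Lp p M f"
  defines "fbar \<equiv> real_cond_exp M (shift_invariant_algebra M) f"
  shows "tendsto_Lp p M (level_average f) fbar"
proof -
  have f: "integrable M f"
    using in_Lp_imp_integrable[OF finite_measure_axioms p Lp] .
  define h where "h = (\<lambda>y. \<bar>f y\<bar> powr p)"
  have h: "integrable M h" using Lp by (simp add: h_def in_Lp_def)
  define hbar where "hbar = real_cond_exp M (shift_invariant_algebra M) h"
  have hbar: "integrable M hbar" "(LINT x|M. hbar x) = (LINT x|M. h x)"
    unfolding hbar_def using invariant.real_cond_exp_int[OF h] by auto
  have hbar_nonneg: "AE x in M. 0 \<le> hbar x"
    unfolding hbar_def using h by (intro invariant.real_cond_exp_pos) (auto simp: h_def)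
  have [measurable]: "level_average f n \<in> borel_measurable M" "fbar \<in> borel_measurable M"
     "level_average h n \<in> borel_measurable M" for n
    using integral_level_average(1)[OF f] integral_level_average(1)[OF h]
    by (auto simp: fbar_def)
  note f_lim = AE_level_average_tendsto[OF f, folded fbar_def]
  note h_lim = AE_level_average_tendsto[OF h, folded hbar_def]
  have jensen: "AE x in M. \<forall>n. \<bar>level_average f n x\<bar> powr p \<le> level_average h n x"
    using AE_tree_summable[OF f] AE_tree_summable[OF h] AE_space
    by eventually_elim (use p in \<open>auto simp: h_def intro!: level_average_powr_le\<close>)
  have fbar_le: "AE x in M. \<bar>fbar x\<bar> powr p \<le> hbar x"
    using f_lim h_lim jensen
  proof eventually_elim
    case (elim x)
    have "(\<lambda>n. \<bar>level_average f n x\<bar> powr p) \<longlonglongrightarrow> \<bar>fbar x\<bar> powr p"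
      using elim(1) p by (intro tendsto_powr' tendsto_rabs tendsto_const) auto
    then show ?case
      using elim(2,3) by (intro LIMSEQ_le) auto
  qed
  have "integrable M (\<lambda>x. \<bar>fbar x\<bar> powr p)"
  proof (rule Bochner_Integration.integrable_bound[OF hbar(1)])
    show "AE x in M. norm (\<bar>fbar x\<bar> powr p) \<le> norm (hbar x)"
      using fbar_le by eventually_elim simp
  qed simp
  then have fbar_Lp: "in_Lp p M fbar"
    by (simp add: in_Lp_def)
  have level_Lp: "in_Lp p M (level_average f n)" for n
  proof -
    have "integrable M (\<lambda>x. \<bar>level_average f n x\<bar> powr p)"
    proof (rule Bochner_Integration.integrable_bound[OF integral_level_average(1)[OF h]])
      show "AE x in M. norm (\<bar>level_average f n x\<bar> powr p) \<le> norm (level_average h n x)"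
        using jensen
      proof eventually_elim
        case (elim x)
        from elim[THEN spec[of _ n]] show ?case by simp
      qed
    qed simp
    then show ?thesis
      by (simp add: in_Lp_def)
  qed
  have h_nonneg: "AE x in M. \<forall>n. 0 \<le> level_average h n x"
    using jensen by eventually_elim (meson order_trans powr_ge_zero)
  have "(\<lambda>n. \<integral>\<^sup>+x. norm (level_average h n x - hbar x) \<partial>M) \<longlonglongrightarrow> 0"
  proof (rule Scheffe_lemma2)
    fix n
    have "(\<integral>\<^sup>+x. norm (level_average h n x) \<partial>M) = ennreal (LINT x|M. level_average h n x)"
      using h_nonneg integral_level_average(1)[OF h]
      by (subst nn_integral_eq_integral[symmetric]) (auto intro!: nn_integral_cong_AE)
    moreover have "(\<integral>\<^sup>+x. norm (hbar x) \<partial>M) = ennreal (LINT x|M. hbar x)"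
      using hbar_nonneg hbar(1)
      by (subst nn_integral_eq_integral[symmetric]) (auto intro!: nn_integral_cong_AE)
    ultimately show "(\<integral>\<^sup>+x. norm (level_average h n x) \<partial>M) \<le> (\<integral>\<^sup>+x. norm (hbar x) \<partial>M)"
      by (simp add: integral_level_average(2)[OF h] hbar(2))
  qed (use hbar h_lim in auto)
  moreover have "(\<integral>\<^sup>+x. norm (level_average h n x - hbar x) \<partial>M) = ennreal (LINT x|M. \<bar>level_average h n x - hbar x\<bar>)" for n
    using hbar(1) integral_level_average(1)[OF h] by (subst nn_integral_eq_integral) auto
  ultimately have "(\<lambda>n. LINT x|M. \<bar>level_average h n x - hbar x\<bar>) \<longlonglongrightarrow> 0"
    by (simp add: ennreal_0[symmetric] del: ennreal_0)
  then have "(\<lambda>n. 2 powr p * (LINT x|M. \<bar>level_average h n x - hbar x\<bar>)) \<longlonglongrightarrow> 2 powr p * 0"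
    by (intro tendsto_mult_left)
  moreover have "(LINT x|M. \<bar>2 powr p * (level_average h n x + hbar x) - 2 powr p * (hbar x + hbar x)\<bar>) =
    2 powr p * (LINT x|M. \<bar>level_average h n x - hbar x\<bar>)" for n
    by (simp add: right_diff_distrib[symmetric] abs_mult)
  ultimately have L1: "(\<lambda>n. LINT x|M. \<bar>2 powr p * (level_average h n x + hbar x) - 2 powr p * (hbar x + hbar x)\<bar>) \<longlonglongrightarrow> 0"
    by simp
  have "(\<lambda>n. LINT x|M. \<bar>level_average f n x - fbar x\<bar> powr p) \<longlonglongrightarrow> 0"
  proof (rule tendsto_integral_zero_dominated_by_L1_convergent[OF _ _ _ _ _ _ _ L1])
    show "AE x in M. (\<lambda>n. \<bar>level_average f n x - fbar x\<bar> powr p) \<longlonglongrightarrow> 0"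
      using f_lim
    proof eventually_elim
      case (elim x)
      have "(\<lambda>n. \<bar>level_average f n x - fbar x\<bar> powr p) \<longlonglongrightarrow> \<bar>fbar x - fbar x\<bar> powr p"
        using elim p by (intro tendsto_powr' tendsto_rabs tendsto_diff tendsto_const) auto
      then show ?case by simp
    qed
    show "AE x in M. \<bar>level_average f n x - fbar x\<bar> powr p \<le> 2 powr p * (level_average h n x + hbar x)" for n
      using jensen fbar_le
    proof eventually_elim
      case (elim x)
      have "\<bar>level_average f n x - fbar x\<bar> powr p \<le> 2 powr p * (\<bar>level_average f n x\<bar> powr p + \<bar>fbar x\<bar> powr p)"
        using p by (intro abs_diff_powr_le) simp
      also have "\<dots> \<le> 2 powr p * (level_average h n x + hbar x)"
        using elim by (intro mult_left_mono add_mono) auto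
      finally show ?case .
    qed
    show "AE x in M. 0 \<le> 2 powr p * (hbar x + hbar x)"
      using hbar_nonneg by eventually_elim simp
  qed (use hbar(1) integral_level_average(1)[OF h] in auto)
  with fbar_Lp level_Lp show ?thesis by (simp add: tendsto_Lp_def)
qed

section \<open>The maximal function\<close>

text \<open>Off a null set the supremum over all trees is reduced to the countably many measurable functions
\<open>best_sum (\<lambda>y. f y - c) n\<close>. This is why its level sets are measurable for the completion.\<close>

lemma AE_maximal_function_gt_iff:
  assumes f: "integrable M f"
  shows "AE x in M. maximal_function S P \<pi> f x > ereal c \<longleftrightarrow> (\<exists>n. 0 < best_sum (\<lambda>y. f y - c) n x)"
proof -
  have g: "integrable M (\<lambda>y. f y - c)" using f by simp
  show ?thesis
    using AE_backward_regular[OF g] AE_tree_summable_trees[OF f]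
  proof eventually_elim
    case (elim x)
    have x: "x \<in> space M" by (rule backward_regularD(1)[OF elim(1)])
    have "c < tree_average P \<pi> f \<tau> x \<longleftrightarrow> 0 < tree_sum (\<lambda>y. f y - c) \<tau> x" if \<tau>: "\<tau> \<in> trees S" for \<tau>
    proof -
      have "tree_sum (\<lambda>y. f y - c) \<tau> x = tree_sum f \<tau> x - c * tree_sum (\<lambda>_. 1) \<tau> x"
        using elim(2) \<tau> tree_summable_one[OF \<tau> x] by (intro tree_sum_diff_invariant) auto
      then show ?thesis
        using tree_sum_one_ge_1[OF \<tau> x] by (simp add: tree_average_eq[OF x] pos_less_divide_eq)
    qed
    then show ?case
      by (simp add: maximal_function_def less_SUP_iff ex_tree_sum_pos_iff[OF elim(1), symmetric])
  qed
qed

lemma maximal_function_inequality: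
  assumes f: "integrable M f"
  defines "A \<equiv> \<lambda>c. {x \<in> space M. maximal_function S P \<pi> f x > ereal c}"
  shows "A c \<in> sets (completion M)"
    and "(LINT x:A c|completion M. f x) \<ge> c * measure (completion M) (A c)"
proof -
  define g where "g = (\<lambda>y. f y - c)"
  have g: "integrable M g" using f by (simp add: g_def)
  define B where "B = {x\<in>space M. \<exists>n. 0 < best_sum g n x}"
  have [measurable]: "f \<in> borel_measurable M" "\<And>n. best_sum g n \<in> borel_measurable M"
    using f g by (auto intro: best_sum_measurable)
  have B [measurable]: "B \<in> sets M" unfolding B_def by measurable
  have ae: "AE x in M. x \<in> B \<longleftrightarrow> x \<in> A c"
    using AE_maximal_function_gt_iff[OF f, of c] AE_space
    by eventually_elim (simp add: A_def B_def g_def)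
  then have ae': "AE x in completion M. x \<in> B \<longleftrightarrow> x \<in> A c"
    by (rule AE_completion)
  show A: "A c \<in> sets (completion M)"
    by (rule completion.in_sets_AE[OF ae']) (auto simp: A_def)
  have B': "B \<in> sets (completion M)" by (rule sets_completionI_sets[OF B])
  have f': "f \<in> borel_measurable (completion M)" by (rule measurable_completion) simp
  have "measure (completion M) (A c) = measure (completion M) B"
  proof (rule measure_eq_AE[OF _ A B'])
    show "AE x in completion M. (x \<in> A c) = (x \<in> B)" using ae' by eventually_elim simp
  qed
  then have m: "measure (completion M) (A c) = measure M B" by simp
  have "(LINT x:A c|completion M. f x) = (LINT x|completion M. indicator B x * f x)"
    unfolding set_lebesgue_integral_def
  proof (rule integral_cong_AE)
    show "AE x in completion M. indicator (A c) x *\<^sub>R f x = indicator B x * f x"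
      using ae' by eventually_elim (simp add: indicator_def)
  qed (use A B' f' in \<open>auto intro!: borel_measurable_times borel_measurable_indicator\<close>)
  also have "\<dots> = (LINT x|M. indicator B x * f x)"
    by (rule integral_completion) simp
  finally have i: "(LINT x:A c|completion M. f x) = (LINT x|M. indicator B x * f x)" .
  have "0 \<le> (LINT x|M. indicator (space M) x * (indicator B x * g x))"
    unfolding B_def by (rule maximal_inequality[OF _ _ g]) (auto simp: stl_in_space)
  also have "\<dots> = (LINT x|M. indicator B x * f x - c * indicator B x)"
    by (rule Bochner_Integration.integral_cong) (auto simp: g_def indicator_def)
  also have "\<dots> = (LINT x|M. indicator B x * f x) - c * measure M B"
  proof -
    have "integrable M (\<lambda>x. indicator B x * f x)" by (rule integrable_indicator_mult[OF B f])
    then show ?thesis by (simp add: less_top[symmetric])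
  qed
  finally show "(LINT x:A c|completion M. f x) \<ge> c * measure (completion M) (A c)"
    by (simp add: i m)
qed

text \<open>Every tree has mass at least \<open>1\<close>, that of the empty word, so the additive constant in the bound on tree
sums also bounds its share in the averages.\<close>

lemma AE_maximal_function_finite:
  assumes f: "integrable M f"
  shows "AE x in M. maximal_function S P \<pi> f x < \<infinity>"
  using AE_tree_sum_near_conditional_expectation[OF f zero_less_one] AE_space
proof eventually_elim
  case (elim x)
  let ?fbar = "real_cond_exp M (shift_invariant_algebra M) f" and ?W = "\<lambda>\<tau>. tree_sum (\<lambda>_. 1) \<tau> x"
  obtain C where C: "0 < C" "\<And>\<tau>. \<tau> \<in> trees S \<Longrightarrow> \<bar>tree_sum f \<tau> x - ?fbar x * ?W \<tau>\<bar> \<le> 1 * ?W \<tau> + C"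
    using elim(1) by blast
  have "tree_average P \<pi> f \<tau> x \<le> ?fbar x + 1 + C" if \<tau>: "\<tau> \<in> trees S" for \<tau>
  proof -
    have W: "1 \<le> ?W \<tau>" by (rule tree_sum_one_ge_1[OF \<tau> elim(2)])
    have "tree_sum f \<tau> x \<le> ?fbar x * ?W \<tau> + ?W \<tau> + C"
      using C(2)[OF \<tau>] by simp
    also have "\<dots> \<le> (?fbar x + 1 + C) * ?W \<tau>"
      using mult_left_mono[OF W, of C] C(1) by (simp add: algebra_simps)
    finally show ?thesis
      using W by (simp add: tree_average_eq[OF elim(2)] pos_divide_le_eq)
  qed
  then have "maximal_function S P \<pi> f x \<le> ereal (?fbar x + 1 + C)"
    unfolding maximal_function_def by (intro SUP_least) simp
  then show ?case by (rule order.strict_trans1) simp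
qed

end

section \<open>The backward ergodic theorem\<close>

theorem corollary5p4:
  fixes S :: "'a set"
    and P :: "'a \<Rightarrow> 'a \<Rightarrow> real"
    and \<pi> :: "'a \<Rightarrow> real"
    and M :: "'a stream measure"
    and p :: real
    and f fbar :: "'a stream \<Rightarrow> real"
  assumes "countable S"
    and "stationary_markov S P \<pi>"
    and "is_markov_path_measure S P \<pi> M"
    and "1 \<le> p"
    and "in_Lp p M f"
    and "fbar = real_cond_exp M (shift_invariant_algebra M) f"
  shows
    "(AE x in M. \<forall>\<tau>\<in>trees S.
        (\<lambda>w. f (w @- x) * markov_word P \<pi> (w @ [shd x])) summable_on \<tau>) \<and>
     (AE x in M. \<forall>\<epsilon>>0. \<exists>K>0. \<forall>\<tau>\<in>trees S. markov_set P \<pi> (app_letter \<tau> (shd x)) \<ge> K \<longrightarrow>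
        \<bar>tree_average P \<pi> f \<tau> x - fbar x\<bar> < \<epsilon>) \<and>
     (AE x in M. (\<lambda>n. 1 / (real (n + 1) * markov_word P \<pi> [shd x]) *
        weighted_sum P \<pi> f (words_le S n) x) \<longlonglongrightarrow> fbar x) \<and>
     tendsto_Lp p M (\<lambda>n x. 1 / (real (n + 1) * markov_word P \<pi> [shd x]) *
        weighted_sum P \<pi> f (words_le S n) x) fbar \<and>
     (\<forall>c::real. {x \<in> space M. maximal_function S P \<pi> f x > ereal c} \<in> sets (completion M) \<and>
        (LINT x:{x \<in> space M. maximal_function S P \<pi> f x > ereal c}|completion M. f x)
          \<ge> c * measure (completion M) {x \<in> space M. maximal_function S P \<pi> f x > ereal c}) \<and>
     (AE x in M. maximal_function S P \<pi> f x < \<infinity>)"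
proof -
  interpret stationary_markov_path S P \<pi> M
    by unfold_locales (rule assms)+
  have f: "integrable M f"
    by (rule in_Lp_imp_integrable[OF finite_measure_axioms assms(4,5)])
  have "AE x in M. \<forall>\<tau>\<in>trees S. (\<lambda>w. f (w @- x) * markov_word P \<pi> (w @ [shd x])) summable_on \<tau>"
    using AE_tree_summable_trees[OF f] AE_space by eventually_elim (simp add: tree_summable_iff)
  moreover note AE_tree_average_converges[OF f, folded assms(6)]
    AE_level_average_tendsto[OF f, folded assms(6), unfolded level_average_def]
    level_average_tendsto_Lp[OF assms(4,5), folded assms(6), unfolded level_average_def[abs_def]]
    maximal_function_inequality[OF f] AE_maximal_function_finite[OF f]
  ultimately show ?thesis by blast
qed

end
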